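(* Let $s=(s_1,\dots,s_n)$ be a composition and $\varepsilon>0$ small enough that $\mathrm h_\varepsilon$ is an admissible height function for the DKK triangulation of $\mathcal F_{\mathcal O(s)}(\mathbf i)$. Then the support (union of all cells) of $\mathrm{Perm}_s(\mathrm h_\varepsilon)$ is a translation of the zonotope $2\sum_{1\le a<c\le n}s_c\,\varepsilon^{c-a}[\mathbf e_a,\mathbf e_c]$.
   Context: $s_{n+1}:=2$. Graph $\mathcal O(s)$: vertices $v_{-1},\dots,v_n$; source edges $e^i_1,\dots,e^i_{s_i-1}$ from $v_{-1}$ to $v_{n+1-i}$ ($i\in[n+1]$); bump $e^i_0$ and dip $e^i_{s_i}$ from $v_{n-i}$ to $v_{n+1-i}$ ($i\in[n]$); framing: incoming at $v_{n+1-i}$: $e^i_0\prec\cdots\prec e^i_{s_i}$; outgoing at $v_{n+1-i}$: $e^{i-1}_0\prec e^{i-1}_{s_{i-1}}$. Routes $R(k,t,\delta)$ ($k\in[n+1]$, $t\in[s_k-1]$, $\delta\in\{0,1\}^{k-1}$) have edges $e^k_t,e^{k-1}_{\delta_{k-1}s_{k-1}},\dots,e^1_{\delta_1s_1}$. Coherence: on each maximal common subpath $v_a\cdots v_b$ ($v_a\ne v_{-1}$, $v_b\ne v_n$), $P$ enters $v_a$ before $Q$ iff $P$ leaves $v_b$ before $Q$ (in the framing orders). The DKK triangulation of $\mathcal F_{\mathcal O(s)}(\mathbf i)=\mathrm{conv}\{\mathbf 1_R\}$ consists of $\mathrm{conv}\{\mathbf 1_R:R\in C\}$ for pairwise coherent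 $C$; $\mathrm h$ is admissible if lifting $\mathbf 1_R$ to height $\mathrm h(R)$ and projecting lower faces yields it. $\mathrm h_\varepsilon(R(k,t,\delta))=-\sum_{k\ge c>a\ge1}\varepsilon^{c-a}(t_c+\delta_a)^2$ with $t_k:=t$ and $t_c:=\delta_cs_c$ for $c<k$. For $k\in[2,n+1]$, $t\in[s_k-1]$, $F^k_t(\mathbf x)=\min_{\delta\in\{0,1\}^{k-1}}(\mathrm h(R(k,t,\delta))+\sum_{i<k}\delta_ix_i)$, $\mathbf x\in\mathbb R^n$; its tropical hypersurface is where the minimum is attained at least twice. $\mathrm{Perm}_s(\mathrm h)$ is the complex of bounded cells of the subdivision of $\mathbb R^n$ induced by the arrangement of these tropical hypersurfaces. $[\mathbf e_a,\mathbf e_c]$ is the segment between the standard basis vectors. *)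

theory Defs
  imports "HOL-Analysis.Analysis" "HOL-Analysis.Finite_Function_Topology"
begin

section \<open>Compositions and the graph O(s)\<close>

text \<open>A composition is a list of positive integers; \<open>part s i\<close> is the 1-based entry
  \<open>s\<^sub>i\<close>, with the convention \<open>s\<^sub>n\<^sub>+\<^sub>1 = 2\<close>.\<close>

definition composition :: "nat list \<Rightarrow> bool" where
  "composition s \<longleftrightarrow> (\<forall>m\<in>set s. 0 < m)"

definition part :: "nat list \<Rightarrow> nat \<Rightarrow> nat" where
  "part s i = (s @ [2]) ! (i - 1)"

text \<open>The edge with upper index \<open>i\<close> and lower index \<open>j\<close> is the pair \<open>(i, j)\<close>; the vertex
  \<open>v\<^sub>j\<close> is the integer \<open>j\<close>, so that the source is \<open>-1\<close> and the sink is \<open>length s\<close>.\<close>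

type_synonym edge = "nat \<times> nat"

definition edges :: "nat list \<Rightarrow> edge set" where
  "edges s = {(i, j). i \<in> {1..length s + 1} \<and> j \<in> {1..part s i - 1}}
           \<union> {(i, j). i \<in> {1..length s} \<and> j \<in> {0, part s i}}"

definition tail :: "nat list \<Rightarrow> edge \<Rightarrow> int" where
  "tail s e = (case e of (i, j) \<Rightarrow>
     if 1 \<le> j \<and> j \<le> part s i - 1 then - 1 else int (length s) - int i)"

definition head :: "nat list \<Rightarrow> edge \<Rightarrow> int" where
  "head s e = (case e of (i, j) \<Rightarrow> int (length s) + 1 - int i)"

text \<open>Two edges with the same head have the same upper index, and so do two edges leaving
  the same vertex other than the source. Both framing orders (on the incoming and on the
  outgoing edges of an inner vertex) compare the lower indices.\<close>

definition framing_less :: "edge \<Rightarrow> edge \<Rightarrow> bool" where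
  "framing_less e f \<longleftrightarrow> fst e = fst f \<and> snd e < snd f"

section \<open>Routes and coherence\<close>

definition cube :: "nat \<Rightarrow> (nat \<Rightarrow> nat) set" where
  "cube m = {1..m} \<rightarrow>\<^sub>E {0, 1}"

text \<open>The triple \<open>(k, t, \<delta>)\<close> stands for the route \<open>R(k, t, \<delta>)\<close>.\<close>

type_synonym route = "nat \<times> nat \<times> (nat \<Rightarrow> nat)"

definition routes :: "nat list \<Rightarrow> route set" where
  "routes s = {(k, t, \<delta>). k \<in> {1..length s + 1} \<and> t \<in> {1..part s k - 1} \<and> \<delta> \<in> cube (k - 1)}"

text \<open>The lower index \<open>t\<^sub>c\<close> of the edge of a route whose upper index is \<open>c\<close>.\<close>

definition level :: "nat list \<Rightarrow> route \<Rightarrow> nat \<Rightarrow> nat" where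
  "level s R c = (case R of (k, t, \<delta>) \<Rightarrow> if c = k then t else \<delta> c * part s c)"

definition route_path :: "nat list \<Rightarrow> route \<Rightarrow> edge list" where
  "route_path s R = map (\<lambda>c. (c, level s R c)) (rev [1..<Suc (fst R)])"

text \<open>In the definition of coherence \<open>M\<close> is the common subpath, possibly consisting of a single
  vertex (\<open>M = []\<close>). It is maximal because the edges before and after it differ, and it neither
  starts at the source nor ends at the sink because there are such edges.\<close>

definition coherent :: "nat list \<Rightarrow> route \<Rightarrow> route \<Rightarrow> bool" where
  "coherent s P Q \<longleftrightarrow>
     (\<forall>P1 P2 Q1 Q2 M.
        route_path s P = P1 @ M @ P2 \<and> route_path s Q = Q1 @ M @ Q2 \<and>
        P1 \<noteq> [] \<and> P2 \<noteq> [] \<and> Q1 \<noteq> [] \<and> Q2 \<noteq> [] \<and>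
        head s (last P1) = head s (last Q1) \<and> last P1 \<noteq> last Q1 \<and>
        tail s (hd P2) = tail s (hd Q2) \<and> hd P2 \<noteq> hd Q2 \<longrightarrow>
        (framing_less (last P1) (last Q1) \<longleftrightarrow> framing_less (hd P2) (hd Q2)))"

text \<open>The encoded routes are exactly the directed paths from the source to the sink.\<close>

definition source_sink_path :: "nat list \<Rightarrow> edge list \<Rightarrow> bool" where
  "source_sink_path s p \<longleftrightarrow> p \<noteq> [] \<and> set p \<subseteq> edges s \<and> tail s (hd p) = - 1 \<and>
     head s (last p) = int (length s) \<and> successively (\<lambda>e f. head s e = tail s f) p"

lemma path_to_sink:
  assumes "p \<noteq> []" "set p \<subseteq> edges s" "successively (\<lambda>e f. head s e = tail s f) p"
    and "head s (last p) = int (length s)"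
  shows "\<exists>\<delta>\<in>cube (fst (hd p) - 1).
           p = hd p # map (\<lambda>c. (c, \<delta> c * part s c)) (rev [1..<fst (hd p)])"
  using assms
proof (induction p)
  case (Cons e p)
  show ?case
  proof (cases p)
    case Nil
    then have "fst e = 1" using Cons.prems by (simp add: head_def split: prod.splits)
    then show ?thesis using Nil by (auto simp: cube_def)
  next
    case (Cons f q)
    obtain i j k l where ef: "e = (i, j)" "f = (k, l)" by fastforce
    have "i \<in> {1..length s + 1}" using Cons.prems ef by (auto simp: edges_def)
    moreover have ht: "head s e = tail s f" using Cons.prems Cons by simp
    ultimately have i: "i = Suc k" and l: "\<not> (1 \<le> l \<and> l \<le> part s k - 1)"
      using ef by (auto simp: head_def tail_def split: if_splits)
    have "f \<in> edges s" using Cons.prems Cons by simp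
    then have k: "k \<ge> 1" and l': "l = 0 \<or> l = part s k" using ef l by (auto simp: edges_def)
    obtain \<delta> where d: "\<delta> \<in> cube (k - 1)"
        "p = f # map (\<lambda>c. (c, \<delta> c * part s c)) (rev [1..<k])"
      using Cons.IH Cons.prems Cons ef by auto
    define \<delta>' where "\<delta>' = \<delta>(k := if l = 0 then 0 else 1)"
    have "\<delta>' \<in> cube k" using d k by (auto simp: cube_def \<delta>'_def PiE_iff extensional_def)
    moreover have "l = \<delta>' k * part s k" using l' by (auto simp: \<delta>'_def)
    moreover have "map (\<lambda>c. (c, \<delta> c * part s c)) (rev [1..<k]) =
        map (\<lambda>c. (c, \<delta>' c * part s c)) (rev [1..<k])"
      by (auto simp: \<delta>'_def)
    ultimately show ?thesis using d i k ef by (intro bexI[of _ \<delta>']) auto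
  qed
qed simp

lemma source_sink_path_iff: "{p. source_sink_path s p} = route_path s ` routes s"
proof (intro set_eqI iffI)
  fix p assume "p \<in> {p. source_sink_path s p}"
  then have p: "source_sink_path s p" by simp
  then obtain \<delta> where d: "\<delta> \<in> cube (fst (hd p) - 1)"
      "p = hd p # map (\<lambda>c. (c, \<delta> c * part s c)) (rev [1..<fst (hd p)])"
    using path_to_sink unfolding source_sink_path_def by blast
  obtain k t where kt: "hd p = (k, t)" by fastforce
  have "(k, t) \<in> edges s" "tail s (k, t) = -1"
    using p kt hd_in_set[of p] by (auto simp: source_sink_path_def)
  then have *: "k \<in> {1..length s + 1}" "t \<in> {1..part s k - 1}"
    by (auto simp: edges_def tail_def split: if_splits)
  then have "(k, t, \<delta>) \<in> routes s" using d kt by (simp add: routes_def)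
  moreover have "route_path s (k, t, \<delta>) = p"
    using d(2) kt * by (subst d(2)) (auto simp: route_path_def level_def)
  ultimately show "p \<in> route_path s ` routes s" by blast
next
  fix p assume "p \<in> route_path s ` routes s"
  then obtain k t \<delta> where R: "(k, t, \<delta>) \<in> routes s" "p = route_path s (k, t, \<delta>)" by auto
  then have k: "k \<in> {1..length s + 1}" and t: "t \<in> {1..part s k - 1}"
    and d: "\<And>c. 1 \<le> c \<Longrightarrow> c < k \<Longrightarrow> \<delta> c = 0 \<or> \<delta> c = 1"
    by (auto simp: routes_def cube_def)
  have nth: "p ! m = (k - m, level s (k, t, \<delta>) (k - m))" if "m < k" for m
    using that k R by (simp add: route_path_def rev_nth Suc_diff_Suc del: upt_Suc)
  have len: "length p = k" using R by (simp add: route_path_def)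
  have "tail s (p ! Suc m) = head s (p ! m)" if "Suc m < k" for m
    using that d[of "k - Suc m"] k nth[of m] nth[of "Suc m"]
    by (auto simp: level_def tail_def head_def)
  then have "successively (\<lambda>e f. head s e = tail s f) p"
    by (auto simp: successively_conv_nth len)
  moreover have "set p \<subseteq> edges s"
    using k t d R by (fastforce simp: edges_def route_path_def level_def)
  moreover have "p \<noteq> []" using k len by auto
  moreover have "head s (last p) = int (length s)"
    using k len nth[of "k - 1"] \<open>p \<noteq> []\<close> by (simp add: last_conv_nth head_def)
  moreover have "tail s (hd p) = -1"
    using k len nth[of 0] t \<open>p \<noteq> []\<close> by (simp add: hd_conv_nth tail_def level_def)
  ultimately show "p \<in> {p. source_sink_path s p}" by (simp add: source_sink_path_def)
qed

section \<open>The DKK triangulation and admissible heights\<close>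

text \<open>Flows are finitely supported functions on edges, a type that is a real vector space.\<close>

definition route_vector :: "nat list \<Rightarrow> route \<Rightarrow> (edge \<Rightarrow>\<^sub>0 real)" where
  "route_vector s R = (\<Sum>e\<in>set (route_path s R). Poly_Mapping.single e 1)"

definition DKK_triangulation :: "nat list \<Rightarrow> (edge \<Rightarrow>\<^sub>0 real) set set" where
  "DKK_triangulation s =
     {convex hull (route_vector s ` C) | C.
        C \<subseteq> routes s \<and> C \<noteq> {} \<and> (\<forall>P\<in>C. \<forall>Q\<in>C. coherent s P Q)}"

definition lifted_polytope :: "nat list \<Rightarrow> (route \<Rightarrow> real) \<Rightarrow> ((edge \<Rightarrow>\<^sub>0 real) \<times> real) set" where
  "lifted_polytope s h = convex hull ((\<lambda>R. (route_vector s R, h R)) ` routes s)"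

text \<open>A lower face is where a linear functional with positive last coefficient, here normalized
  to 1, is minimal.\<close>

definition lower_faces :: "('a::real_vector \<times> real) set \<Rightarrow> ('a \<times> real) set set" where
  "lower_faces P =
     {{p\<in>P. \<forall>q\<in>P. l (fst p) + snd p \<le> l (fst q) + snd q} | l :: 'a \<Rightarrow> real. linear l}"

definition admissible :: "nat list \<Rightarrow> (route \<Rightarrow> real) \<Rightarrow> bool" where
  "admissible s h \<longleftrightarrow> (`) fst ` lower_faces (lifted_polytope s h) = DKK_triangulation s"

definition h_eps :: "nat list \<Rightarrow> real \<Rightarrow> route \<Rightarrow> real" where
  "h_eps s \<epsilon> R = (case R of (k, t, \<delta>) \<Rightarrow>
     - (\<Sum>(a, c)\<in>{(a, c). 1 \<le> a \<and> a < c \<and> c \<le> k}.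
          \<epsilon> ^ (c - a) * (real (level s R c) + real (\<delta> a))\<^sup>2))"

section \<open>The arrangement of tropical hypersurfaces\<close>

text \<open>Coordinates of \<open>\<real>\<^sup>n\<close> are indexed by an arbitrary linearly ordered type with \<open>n\<close> elements;
  \<open>ix i\<close> is its \<open>i\<close>-th element, for \<open>1 \<le> i \<le> n\<close>.\<close>

definition ix :: "nat \<Rightarrow> 'n::{finite,linorder}" where
  "ix i = sorted_list_of_set (UNIV :: 'n set) ! (i - 1)"

definition trop_term ::
    "(route \<Rightarrow> real) \<Rightarrow> nat \<Rightarrow> nat \<Rightarrow> real ^ 'n::{finite,linorder} \<Rightarrow> (nat \<Rightarrow> nat) \<Rightarrow> real" where
  "trop_term h k t x \<delta> = h (k, t, \<delta>) + (\<Sum>i=1..<k. real (\<delta> i) * x $ ix i)"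

definition trop_poly ::
    "(route \<Rightarrow> real) \<Rightarrow> nat \<Rightarrow> nat \<Rightarrow> real ^ 'n::{finite,linorder} \<Rightarrow> real" where
  "trop_poly h k t x = Min (trop_term h k t x ` cube (k - 1))"

definition trop_hypersurface ::
    "(route \<Rightarrow> real) \<Rightarrow> nat \<Rightarrow> nat \<Rightarrow> (real ^ 'n::{finite,linorder}) set" where
  "trop_hypersurface h k t =
     {x. \<exists>\<delta>\<in>cube (k - 1). \<exists>\<delta>'\<in>cube (k - 1). \<delta> \<noteq> \<delta>' \<and>
         trop_term h k t x \<delta> = trop_poly h k t x \<and> trop_term h k t x \<delta>' = trop_poly h k t x}"

definition trop_arrangement ::
    "nat list \<Rightarrow> (route \<Rightarrow> real) \<Rightarrow> (real ^ 'n::{finite,linorder}) set set" where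
  "trop_arrangement s h =
     {trop_hypersurface h k t | k t. k \<in> {2..length s + 1} \<and> t \<in> {1..part s k - 1}}"

text \<open>The maximal cells of the subdivision induced by an arrangement are the closures of the
  connected components of its complement; its cells are all nonempty faces of these.\<close>

definition induced_subdivision :: "'a::real_normed_vector set set \<Rightarrow> 'a set set" where
  "induced_subdivision \<H> =
     {G. G \<noteq> {} \<and> (\<exists>D\<in>components (- \<Union>\<H>). G face_of closure D)}"

definition Perm :: "nat list \<Rightarrow> (route \<Rightarrow> real) \<Rightarrow> (real ^ 'n::{finite,linorder}) set set" where
  "Perm s h = {G \<in> induced_subdivision (trop_arrangement s h). bounded G}"

section \<open>The zonotope\<close>

text \<open>The sum of sets is the Minkowski sum.\<close>

definition zonotope :: "nat list \<Rightarrow> real \<Rightarrow> (real ^ 'n::{finite,linorder}) set" where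
  "zonotope s \<epsilon> = (*\<^sub>R) 2 `
     (\<Sum>(a, c)\<in>{(a, c). 1 \<le> a \<and> a < c \<and> c \<le> length s}.
        (*\<^sub>R) (real (part s c) * \<epsilon> ^ (c - a)) ` closed_segment (axis (ix a) 1) (axis (ix c) 1))"

end

(* A point x determines, for every tropical polynomial F^k_t, the set of its minimizing vertices
   delta, and the smallest cell through x consists of the points whose minimizer sets contain those
   of x. So the support is the set of points x whose smallest cell is bounded. A coordinate direction
   e_i or -e_i recedes unless both values of delta_i occur among the minimizers at x.

   The routes R(k,t,delta) that minimize at a common point x form a lower face of the lifted flow
   polytope, so admissibility makes them pairwise coherent. Coherence carries the occurrence of both
   values of delta_i from the polynomials with k <= n over to F^{n+1}_1, by downward induction on i,
   and orders the minimizers of F^{n+1}_1 linearly. Hence boundedness forces delta = 0 and delta = 1 to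
   minimize F^{n+1}_1 at x, and conversely these two conditions bound the cell.

   The quadratic part of F^{n+1}_1 is -2 sum_{a<c} s_c eps^{c-a} delta_a delta_c. Therefore 0 and 1 are
   both minimizers exactly on a translate of the base polytope of a supermodular function of graphical
   type, which is the zonotope: its support function is the Lovasz extension. *)
theory Submission
  imports Defs
begin

section \<open>Cells of an arrangement of tropical hypersurfaces\<close>

text \<open>Abstracts the arrangement to minima of finitely many affine functions, one minimum per
  index. Distinct labels of one index have distinct gradients, so two of its functions agree only on
  a hyperplane.\<close>

locale affine_family =
  fixes I :: "'p set" and C :: "'p \<Rightarrow> 'd set"
    and b :: "'p \<Rightarrow> 'd \<Rightarrow> real" and g :: "'p \<Rightarrow> 'd \<Rightarrow> 'a::euclidean_space"
  assumes finite_index: "finite I"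
    and finite_labels: "p \<in> I \<Longrightarrow> finite (C p)"
    and labels_nonempty: "p \<in> I \<Longrightarrow> C p \<noteq> {}"
    and inj_gradient: "p \<in> I \<Longrightarrow> inj_on (g p) (C p)"
begin

definition val :: "'p \<Rightarrow> 'd \<Rightarrow> 'a \<Rightarrow> real" where
  "val p d x = b p d + g p d \<bullet> x"

definition minimizers :: "'p \<Rightarrow> 'a \<Rightarrow> 'd set" where
  "minimizers p x = {d \<in> C p. \<forall>d'\<in>C p. val p d x \<le> val p d' x}"

definition hypersurface :: "'p \<Rightarrow> 'a set" where
  "hypersurface p = {x. \<exists>d\<in>minimizers p x. \<exists>d'\<in>minimizers p x. d \<noteq> d'}"

text \<open>The smallest cell containing the given point.\<close>

definition carrier_cell :: "'a \<Rightarrow> 'a set" where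
  "carrier_cell x = {y. \<forall>p\<in>I. minimizers p x \<subseteq> minimizers p y}"

text \<open>A choice \<open>\<sigma>\<close> of one label per index acts like a sign vector.
  Incompatible choices give an empty region, hence the witness \<open>z\<close> in the lemmas
  below.\<close>

definition region :: "('p \<Rightarrow> 'd) \<Rightarrow> 'a set" where
  "region \<sigma> = {x. \<forall>p\<in>I. \<forall>d\<in>C p. d \<noteq> \<sigma> p \<longrightarrow> val p (\<sigma> p) x < val p d x}"

definition closed_region :: "('p \<Rightarrow> 'd) \<Rightarrow> 'a set" where
  "closed_region \<sigma> = {x. \<forall>p\<in>I. \<forall>d\<in>C p. val p (\<sigma> p) x \<le> val p d x}"

lemma continuous_val [continuous_intros]: "continuous_on S (val p d)"
  unfolding val_def by (intro continuous_intros)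

lemma val_affine: "val p d ((1 - u) *\<^sub>R x + u *\<^sub>R y) = (1 - u) * val p d x + u * val p d y"
  by (simp add: val_def inner_add_right algebra_simps)

lemma minimizers_nonempty:
  assumes "p \<in> I"
  shows "minimizers p x \<noteq> {}"
proof -
  obtain d where "d \<in> C p" "\<forall>d'\<in>C p. val p d x \<le> val p d' x"
    using ex_min_if_finite[of "(\<lambda>d. val p d x) ` C p"] finite_labels[OF assms]
      labels_nonempty[OF assms] by (force simp: not_less)
  then show ?thesis by (auto simp: minimizers_def)
qed

lemma minimizers_subset: "d \<in> minimizers p x \<Longrightarrow> d \<in> C p"
  by (simp add: minimizers_def)

lemma minimizers_le: "d \<in> minimizers p x \<Longrightarrow> d' \<in> C p \<Longrightarrow> val p d x \<le> val p d' x"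
  by (simp add: minimizers_def)

lemma minimizers_val_eq:
  "d \<in> minimizers p x \<Longrightarrow> d' \<in> minimizers p x \<Longrightarrow> val p d x = val p d' x"
  by (intro antisym minimizers_le minimizers_subset)

lemma minimizers_cong:
  "d \<in> minimizers p x \<Longrightarrow> d' \<in> C p \<Longrightarrow> val p d' x = val p d x \<Longrightarrow> d' \<in> minimizers p x"
  by (simp add: minimizers_def)

lemma closed_region_iff:
  assumes "\<And>p. p \<in> I \<Longrightarrow> \<sigma> p \<in> C p"
  shows "x \<in> closed_region \<sigma> \<longleftrightarrow> (\<forall>p\<in>I. \<sigma> p \<in> minimizers p x)"
  using assms by (auto simp: closed_region_def minimizers_def)

section \<open>Regions as connected components of the complement\<close>

lemma open_region: "open (region \<sigma>)"
proof -
  have "region \<sigma> = (\<Inter>p\<in>I. \<Inter>d\<in>C p - {\<sigma> p}. {x. val p (\<sigma> p) x < val p d x})"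
    by (auto simp: region_def)
  also have "open \<dots>"
    using finite_index finite_labels
    by (intro open_INT ballI finite_Diff open_Collect_less continuous_intros) auto
  finally show ?thesis .
qed

lemma closed_closed_region: "closed (closed_region \<sigma>)"
proof -
  have "closed_region \<sigma> = (\<Inter>p\<in>I. \<Inter>d\<in>C p. {x. val p (\<sigma> p) x \<le> val p d x})"
    by (auto simp: closed_region_def)
  also have "closed \<dots>"
    by (intro closed_INT ballI closed_Collect_le continuous_intros)
  finally show ?thesis .
qed

lemma convex_region: "convex (region \<sigma>)"
proof (rule convexI)
  fix x y u v assume *: "x \<in> region \<sigma>" "y \<in> region \<sigma>" "0 \<le> u" "0 \<le> v" "u + v = (1::real)"
  then have u: "u = 1 - v" by simp
  show "u *\<^sub>R x + v *\<^sub>R y \<in> region \<sigma>"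
    unfolding region_def u val_affine mem_Collect_eq
  proof (intro ballI impI)
    fix p d assume "p \<in> I" "d \<in> C p" "d \<noteq> \<sigma> p"
    then have "val p (\<sigma> p) x < val p d x" "val p (\<sigma> p) y < val p d y"
      using * by (auto simp: region_def)
    then have "0 < (1 - v) * (val p d x - val p (\<sigma> p) x) + v * (val p d y - val p (\<sigma> p) y)"
      using * u by (cases "v = 0") (auto intro: add_nonneg_pos)
    then show "(1 - v) * val p (\<sigma> p) x + v * val p (\<sigma> p) y < (1 - v) * val p d x + v * val p d y"
      by (simp add: algebra_simps)
  qed
qed

lemma region_disjoint:
  assumes "\<And>p. p \<in> I \<Longrightarrow> \<sigma> p \<in> C p"
  shows "region \<sigma> \<subseteq> - \<Union> (hypersurface ` I)"
proof
  fix x assume x: "x \<in> region \<sigma>"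
  have "x \<notin> hypersurface p" if p: "p \<in> I" for p
  proof -
    have "d = \<sigma> p" if "d \<in> minimizers p x" "\<sigma> p \<in> C p" for d
      using x p that by (fastforce simp: region_def minimizers_def)
    then show ?thesis using assms[OF p] by (auto simp: hypersurface_def)
  qed
  then show "x \<in> - \<Union> (hypersurface ` I)" by blast
qed

text \<open>Here \<open>\<sigma> p\<close> is a minimizer, and off the hypersurface of
  \<open>p\<close> there is only one. Hence a region is relatively closed in the complement of the
  arrangement.\<close>

lemma closed_region_off_hypersurfaces:
  assumes "\<And>p. p \<in> I \<Longrightarrow> \<sigma> p \<in> C p"
  shows "closed_region \<sigma> - \<Union> (hypersurface ` I) \<subseteq> region \<sigma>"
proof
  fix x assume x: "x \<in> closed_region \<sigma> - \<Union> (hypersurface ` I)"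
  show "x \<in> region \<sigma>" unfolding region_def mem_Collect_eq
  proof (intro ballI impI)
    fix p d assume pd: "p \<in> I" "d \<in> C p" "d \<noteq> \<sigma> p"
    have s: "\<sigma> p \<in> minimizers p x"
      using x pd assms[OF pd(1)] by (auto simp: closed_region_def minimizers_def)
    then have "d \<notin> minimizers p x" using x pd by (auto simp: hypersurface_def)
    then show "val p (\<sigma> p) x < val p d x"
      using s pd by (force simp: minimizers_def not_le)
  qed
qed

lemma region_subset_closed_region: "region \<sigma> \<subseteq> closed_region \<sigma>"
  unfolding region_def closed_region_def by (force simp: less_le)

text \<open>A region is convex, so it lies in one component. Conversely, the region and the
  complement of \<open>closed_region \<sigma>\<close> are disjoint open sets covering the component,
  which therefore cannot leave the region.\<close>

lemma region_eq_connected_component: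
  assumes \<sigma>: "\<And>p. p \<in> I \<Longrightarrow> \<sigma> p \<in> C p" and z: "z \<in> region \<sigma>"
  shows "connected_component_set (- \<Union> (hypersurface ` I)) z = region \<sigma>"
proof
  let ?U = "- \<Union> (hypersurface ` I)"
  let ?D = "connected_component_set ?U z"
  show "region \<sigma> \<subseteq> ?D"
    using z region_disjoint[OF \<sigma>]
    by (intro connected_component_maximal convex_connected convex_region) auto
  have D: "?D \<subseteq> ?U" "z \<in> ?D"
    using z region_disjoint[OF \<sigma>] connected_component_subset[of ?U z]
    by (blast, simp add: subset_iff)
  show "?D \<subseteq> region \<sigma>"
  proof (rule ccontr)
    assume *: "\<not> ?D \<subseteq> region \<sigma>"
    have "?D \<subseteq> region \<sigma> \<union> - closed_region \<sigma>"
      using D closed_region_off_hypersurfaces[OF \<sigma>] by blast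
    moreover have "region \<sigma> \<inter> - closed_region \<sigma> \<inter> ?D = {}"
      using region_subset_closed_region[of \<sigma>] by blast
    moreover have "region \<sigma> \<inter> ?D \<noteq> {}" using D z by blast
    moreover have "- closed_region \<sigma> \<inter> ?D \<noteq> {}"
      using * D closed_region_off_hypersurfaces[OF \<sigma>] by blast
    ultimately have "\<not> connected ?D"
      unfolding connected_def not_not
      using open_region[of \<sigma>] closed_closed_region[of \<sigma>] open_Compl by blast
    then show False by simp
  qed
qed

text \<open>Moving from a point \<open>y\<close> of the closed region towards \<open>z\<close> makes
  every weak inequality strict at once, so \<open>y\<close> is a limit of points of the
  region.\<close>

lemma closure_region:
  assumes z: "z \<in> region \<sigma>"
  shows "closure (region \<sigma>) = closed_region \<sigma>"
proof
  show "closure (region \<sigma>) \<subseteq> closed_region \<sigma>"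
    by (intro closure_minimal region_subset_closed_region closed_closed_region)
  show "closed_region \<sigma> \<subseteq> closure (region \<sigma>)"
  proof
    fix y assume y: "y \<in> closed_region \<sigma>"
    have "(1 - u) *\<^sub>R y + u *\<^sub>R z \<in> region \<sigma>" if "0 < u" "u < 1" for u
      unfolding region_def val_affine mem_Collect_eq
    proof (intro ballI impI add_le_less_mono)
      fix p d assume "p \<in> I" "d \<in> C p" "d \<noteq> \<sigma> p"
      then show "(1 - u) * val p (\<sigma> p) y \<le> (1 - u) * val p d y" "u * val p (\<sigma> p) z < u * val p d z"
        using y z that by (auto simp: region_def closed_region_def)
    qed
    then have "\<forall>\<^sub>F u in at_right 0. (1 - u) *\<^sub>R y + u *\<^sub>R z \<in> region \<sigma>"
      using eventually_at_right_less[of "0::real"] eventually_at_right_real[of 0 "1::real"]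
      by (simp add: eventually_mono)
    moreover have "((\<lambda>u. (1 - u) *\<^sub>R y + u *\<^sub>R z) \<longlongrightarrow> (1 - 0) *\<^sub>R y + 0 *\<^sub>R z) (at_right (0::real))"
      by (intro tendsto_intros)
    ultimately show "y \<in> closure (region \<sigma>)"
      using closure_subset
      by (intro Lim_in_closed_set[where F = "at_right (0::real)"])
        (auto elim!: eventually_mono)
  qed
qed

section \<open>Regions near a given point\<close>

lemma region_through:
  assumes "x \<notin> \<Union> (hypersurface ` I)"
  obtains \<sigma> where "\<And>p. p \<in> I \<Longrightarrow> \<sigma> p \<in> C p" "x \<in> region \<sigma>"
proof -
  have "\<exists>\<sigma>. \<forall>p\<in>I. \<sigma> p \<in> minimizers p x"
    using minimizers_nonempty by (intro bchoice) auto
  then obtain \<sigma> where \<sigma>: "\<And>p. p \<in> I \<Longrightarrow> \<sigma> p \<in> minimizers p x" by blast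
  then have C: "\<And>p. p \<in> I \<Longrightarrow> \<sigma> p \<in> C p" and "x \<in> closed_region \<sigma>"
    by (auto simp: minimizers_def closed_region_def)
  then show ?thesis using that[of \<sigma>] closed_region_off_hypersurfaces[of \<sigma>] assms by blast
qed

text \<open>A label that does not minimize at \<open>x\<close> is strictly beaten by another one. By
  continuity this persists for small steps, and there are finitely many labels.\<close>

lemma small_step:
  "\<forall>\<^sub>F u in at_right 0. \<forall>p\<in>I. minimizers p (x + u *\<^sub>R v) \<subseteq> minimizers p x"
proof -
  have "\<forall>\<^sub>F u in at_right 0. \<forall>p\<in>I. \<forall>d\<in>C p - minimizers p x.
      d \<notin> minimizers p (x + u *\<^sub>R v)"
  proof (intro eventually_ball_finite ballI finite_index finite_Diff finite_labels)
    fix p d assume p: "p \<in> I" and d: "d \<in> C p - minimizers p x"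
    then obtain d' where d': "d' \<in> C p" "val p d' x < val p d x"
      by (force simp: minimizers_def not_le)
    have "((\<lambda>u. val p d (x + u *\<^sub>R v) - val p d' (x + u *\<^sub>R v)) \<longlongrightarrow>
        val p d (x + 0 *\<^sub>R v) - val p d' (x + 0 *\<^sub>R v)) (at_right (0::real))"
      unfolding val_def by (intro tendsto_intros)
    then have "\<forall>\<^sub>F u in at_right 0. 0 < val p d (x + u *\<^sub>R v) - val p d' (x + u *\<^sub>R v)"
      using d' by (intro order_tendstoD) auto
    then show "\<forall>\<^sub>F u in at_right 0. d \<notin> minimizers p (x + u *\<^sub>R v)"
      by eventually_elim (use d' in \<open>force simp: minimizers_def\<close>)
  qed
  then show ?thesis by eventually_elim (auto simp: minimizers_def)
qed

text \<open>The bad directions lie in finitely many hyperplanes orthogonal to gradient differences,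
  which are nonzero by \<open>inj_gradient\<close>; their union is negligible.\<close>

lemma exists_generic_direction:
  "\<exists>v. \<forall>p\<in>I. \<forall>d\<in>C p. \<forall>d'\<in>C p. d \<noteq> d' \<longrightarrow> g p d \<bullet> v \<noteq> g p d' \<bullet> v"
proof -
  define T where "T = (SIGMA p:I. {(d, d'). d \<in> C p \<and> d' \<in> C p \<and> d \<noteq> d'})"
  define N where "N = \<Union> ((\<lambda>(p, d, d'). {v. (g p d - g p d') \<bullet> v = 0}) ` T)"
  have "finite T"
    unfolding T_def
    by (intro finite_SigmaI finite_index, rule finite_subset[of _ "C _ \<times> C _"])
      (auto simp: finite_labels)
  then have "negligible N"
    unfolding N_def using inj_gradient
    by (intro negligible_Union finite_imageI) (auto simp: T_def inj_on_def intro!: negligible_hyperplane)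
  then obtain v where "v \<notin> N" using non_negligible_UNIV by (metis UNIV_eq_I)
  then show ?thesis
    by (intro exI[of _ v]) (fastforce simp: N_def T_def inner_diff_left)
qed

text \<open>Serves points on the hypersurfaces: a small step in a generic direction leaves all of
  them, and the minimizers found there already minimize at \<open>x\<close>.\<close>

lemma region_near:
  obtains \<sigma> where "\<And>p. p \<in> I \<Longrightarrow> \<sigma> p \<in> C p" "region \<sigma> \<noteq> {}" "x \<in> closed_region \<sigma>"
proof -
  obtain v where v: "\<And>p d d'. p \<in> I \<Longrightarrow> d \<in> C p \<Longrightarrow> d' \<in> C p \<Longrightarrow> d \<noteq> d' \<Longrightarrow> g p d \<bullet> v \<noteq> g p d' \<bullet> v"
    using exists_generic_direction by metis
  have "\<forall>\<^sub>F u in at_right (0::real). 0 < u \<and> (\<forall>p\<in>I. minimizers p (x + u *\<^sub>R v) \<subseteq> minimizers p x)"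
    using small_step eventually_at_right_less by (rule eventually_conj[rotated])
  then obtain u where u: "0 < u" "\<And>p. p \<in> I \<Longrightarrow> minimizers p (x + u *\<^sub>R v) \<subseteq> minimizers p x"
    by (metis (mono_tags, lifting) eventually_happens' trivial_limit_at_right_real)
  let ?y = "x + u *\<^sub>R v"
  have "?y \<notin> hypersurface p" if p: "p \<in> I" for p
  proof
    assume "?y \<in> hypersurface p"
    then obtain d d' where d: "d \<in> minimizers p ?y" "d' \<in> minimizers p ?y" "d \<noteq> d'"
      by (auto simp: hypersurface_def)
    \<comment> \<open>A tie at both \<open>x\<close> and \<open>?y\<close> forces equal slopes along
      \<open>v\<close>, against genericity.\<close>
    then have "val p d ?y = val p d' ?y" "val p d x = val p d' x" "d \<in> C p" "d' \<in> C p"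
      using u(2)[OF p] minimizers_val_eq minimizers_subset by blast+
    moreover from this have "u * (g p d \<bullet> v) = u * (g p d' \<bullet> v)"
      unfolding val_def inner_add_right inner_scaleR_right by linarith
    ultimately show False
      using v[OF p, of d d'] d u(1) by simp
  qed
  then obtain \<sigma> where \<sigma>: "\<And>p. p \<in> I \<Longrightarrow> \<sigma> p \<in> C p" "?y \<in> region \<sigma>"
    using region_through[of ?y] by blast
  have "\<sigma> p \<in> minimizers p x" if "p \<in> I" for p
    using \<sigma>(2) that u(2)[OF that] region_subset_closed_region[of \<sigma>] closed_region_iff[OF \<sigma>(1), of ?y]
    by blast
  then have "x \<in> closed_region \<sigma>" using closed_region_iff[OF \<sigma>(1)] by blast
  then show ?thesis using \<sigma> that by blast
qed

section \<open>Carrier cells as faces\<close>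

lemma carrier_cell_subset:
  assumes "\<And>p. p \<in> I \<Longrightarrow> \<sigma> p \<in> C p" "x \<in> closed_region \<sigma>"
  shows "carrier_cell x \<subseteq> closed_region \<sigma>"
  using closed_region_iff[OF assms(1)] assms(2) by (auto simp: carrier_cell_def)

text \<open>The carrier cell is cut out of the closed region by turning some of its defining weak
  inequalities into equalities, and such a set is a face.\<close>

lemma carrier_cell_face:
  assumes \<sigma>: "\<And>p. p \<in> I \<Longrightarrow> \<sigma> p \<in> C p" and x: "x \<in> closed_region \<sigma>"
  shows "carrier_cell x face_of closed_region \<sigma>"
proof -
  have cell: "carrier_cell x = {y \<in> closed_region \<sigma>.
      \<forall>p\<in>I. \<forall>d\<in>minimizers p x. val p d y = val p (\<sigma> p) y}" (is "_ = ?Q")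
  proof
    show "carrier_cell x \<subseteq> ?Q"
    proof
      fix y assume y: "y \<in> carrier_cell x"
      then have y': "y \<in> closed_region \<sigma>" using carrier_cell_subset[OF assms] by blast
      then have "val p d y = val p (\<sigma> p) y" if "p \<in> I" "d \<in> minimizers p x" for p d
        using y that closed_region_iff[OF \<sigma>, of y]
        by (intro minimizers_val_eq[where x = y]) (auto simp: carrier_cell_def)
      then show "y \<in> ?Q" using y' by blast
    qed
    show "?Q \<subseteq> carrier_cell x"
      using closed_region_iff[OF \<sigma>] minimizers_cong minimizers_subset
      unfolding carrier_cell_def by blast
  qed
  show ?thesis
    unfolding face_of_def
  proof (intro conjI ballI impI)
    show "carrier_cell x \<subseteq> closed_region \<sigma>" using carrier_cell_subset[OF assms] .
    show "convex (carrier_cell x)"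
    proof (rule convexI)
      fix y z u v
      assume *: "y \<in> carrier_cell x" "z \<in> carrier_cell x" "0 \<le> u" "0 \<le> v" "u + v = (1::real)"
      then have u: "u = 1 - v" by simp
      show "u *\<^sub>R y + v *\<^sub>R z \<in> carrier_cell x"
        unfolding carrier_cell_def mem_Collect_eq
      proof (intro ballI subsetI)
        fix p d assume p: "p \<in> I" and d: "d \<in> minimizers p x"
        then have "d \<in> minimizers p y" "d \<in> minimizers p z" using * by (auto simp: carrier_cell_def)
        then show "d \<in> minimizers p (u *\<^sub>R y + v *\<^sub>R z)"
          using * unfolding u minimizers_def mem_Collect_eq val_affine
          by (auto intro!: add_mono mult_left_mono)
      qed
    qed
    fix y z q
    assume yz: "y \<in> closed_region \<sigma>" "z \<in> closed_region \<sigma>" and q: "q \<in> carrier_cell x"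
      and "q \<in> open_segment y z"
    then obtain u where u: "0 < u" "u < 1" "q = (1 - u) *\<^sub>R y + u *\<^sub>R z"
      by (auto simp: in_segment)
    have "val p d y = val p (\<sigma> p) y \<and> val p d z = val p (\<sigma> p) z"
      if "p \<in> I" "d \<in> minimizers p x" for p d
    proof -
      have d: "d \<in> C p" using that by (auto simp: minimizers_def)
      have 1: "val p (\<sigma> p) y \<le> val p d y" "val p (\<sigma> p) z \<le> val p d z"
        using yz that d by (auto simp: closed_region_def)
      have "val p d q = val p (\<sigma> p) q" using q that unfolding cell by auto
      \<comment> \<open>Two nonnegative terms with sum zero both vanish, so the equalities at
        \<open>q\<close> pass to both ends of the segment.\<close>
      then have "(1 - u) * (val p d y - val p (\<sigma> p) y) + u * (val p d z - val p (\<sigma> p) z) = 0"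
        unfolding u(3) val_affine by (simp add: algebra_simps)
      moreover have "0 \<le> (1 - u) * (val p d y - val p (\<sigma> p) y)" "0 \<le> u * (val p d z - val p (\<sigma> p) z)"
        using 1 u by auto
      ultimately show ?thesis using u by (simp add: add_nonneg_eq_0_iff)
    qed
    then show "y \<in> carrier_cell x" "z \<in> carrier_cell x" using yz by (auto simp: cell)
  qed
qed

text \<open>The point \<open>x\<close> behaves like a relative interior point of its carrier cell:
  the segment from \<open>y\<close> to \<open>x\<close> can be prolonged beyond \<open>x\<close>
  inside the cell. A face containing \<open>x\<close> then contains \<open>y\<close>.\<close>

lemma carrier_cell_subset_face:
  assumes "\<And>p. p \<in> I \<Longrightarrow> \<sigma> p \<in> C p" and G: "G face_of closed_region \<sigma>" and x: "x \<in> G"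
  shows "carrier_cell x \<subseteq> G"
proof
  fix y assume y: "y \<in> carrier_cell x"
  have K: "carrier_cell x \<subseteq> closed_region \<sigma>"
    using carrier_cell_subset[OF assms(1)] G x face_of_imp_subset by blast
  show "y \<in> G"
  proof (cases "y = x")
    case False
    have "\<forall>\<^sub>F u in at_right (0::real). 0 < u \<and>
        (\<forall>p\<in>I. minimizers p (x + u *\<^sub>R (x - y)) \<subseteq> minimizers p x)"
      using small_step eventually_at_right_less by (rule eventually_conj[rotated])
    then obtain u where u: "0 < u"
        "\<And>p. p \<in> I \<Longrightarrow> minimizers p (x + u *\<^sub>R (x - y)) \<subseteq> minimizers p x"
      by (metis (mono_tags, lifting) eventually_happens' trivial_limit_at_right_real)
    let ?z = "x + u *\<^sub>R (x - y)"
    \<comment> \<open>\<open>small_step\<close> gives only one inclusion. For the other, labels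
      minimizing at \<open>x\<close> tie at \<open>x\<close> and at \<open>y\<close>, hence along
      the whole line; as one of them minimizes at \<open>?z\<close>, all do.\<close>
    have "d \<in> minimizers p ?z" if p: "p \<in> I" and d: "d \<in> minimizers p x" for p d
    proof -
      obtain d' where d': "d' \<in> minimizers p ?z" using minimizers_nonempty[OF p] by blast
      then have "d' \<in> minimizers p x" using u p by blast
      moreover have "minimizers p x \<subseteq> minimizers p y" using y p by (auto simp: carrier_cell_def)
      ultimately have "val p d x = val p d' x" "val p d y = val p d' y"
        using d minimizers_val_eq by blast+
      moreover have "val p e ?z = (1 + u) * val p e x - u * val p e y" for e
        using val_affine[of p e "- u" x y] by (simp add: algebra_simps)
      ultimately have "val p d ?z = val p d' ?z" by simp
      then show ?thesis using minimizers_cong[OF d'] minimizers_subset[OF d] by simp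
    qed
    then have "?z \<in> carrier_cell x" by (auto simp: carrier_cell_def)
    moreover have "x \<in> open_segment y ?z"
    proof -
      have "x = (1 - 1 / (1 + u)) *\<^sub>R y + (1 / (1 + u)) *\<^sub>R ?z"
      proof -
        have "(1 / (1 + u)) *\<^sub>R ?z = (1 / (1 + u)) *\<^sub>R ((1 + u) *\<^sub>R x - u *\<^sub>R y)"
          by (simp add: algebra_simps)
        also have "\<dots> = x - (u / (1 + u)) *\<^sub>R y"
          using u by (simp add: scaleR_diff_right)
        finally show ?thesis using u by (simp add: field_simps)
      qed
      moreover have "y \<noteq> ?z"
      proof
        assume "y = ?z"
        then have "(1 + u) *\<^sub>R (x - y) = 0" by (simp add: algebra_simps)
        then show False using u False by simp
      qed
      ultimately show ?thesis using u by (auto simp: in_segment intro!: exI[of _ "1 / (1 + u)"])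
    qed
    ultimately show ?thesis using G x y K unfolding face_of_def by blast
  qed (use x in simp)
qed

text \<open>Every cell through \<open>x\<close> contains \<open>carrier_cell x\<close>, which is
  itself a cell; so \<open>x\<close> lies in a bounded cell exactly when its carrier cell is
  bounded.\<close>

theorem Union_bounded_cells:
  "\<Union> {G \<in> induced_subdivision (hypersurface ` I). bounded G} = {x. bounded (carrier_cell x)}"
proof (intro equalityI subsetI)
  fix x assume "x \<in> \<Union> {G \<in> induced_subdivision (hypersurface ` I). bounded G}"
  then obtain G D where G: "x \<in> G" "bounded G" "G face_of closure D"
      and D: "D \<in> components (- \<Union> (hypersurface ` I))"
    by (auto simp: induced_subdivision_def)
  obtain z where z: "z \<notin> \<Union> (hypersurface ` I)"
      "D = connected_component_set (- \<Union> (hypersurface ` I)) z"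
    using D by (auto simp: components_def)
  obtain \<sigma> where \<sigma>: "\<And>p. p \<in> I \<Longrightarrow> \<sigma> p \<in> C p" "z \<in> region \<sigma>"
    using region_through[OF z(1)] by blast
  then have "closure D = closed_region \<sigma>"
    using z region_eq_connected_component closure_region by metis
  then have "carrier_cell x \<subseteq> G"
    using carrier_cell_subset_face[OF \<sigma>(1)] G by metis
  then show "x \<in> {x. bounded (carrier_cell x)}" using G bounded_subset by blast
next
  fix x assume x: "x \<in> {x. bounded (carrier_cell x)}"
  obtain \<sigma> where \<sigma>: "\<And>p. p \<in> I \<Longrightarrow> \<sigma> p \<in> C p" "region \<sigma> \<noteq> {}" "x \<in> closed_region \<sigma>"
    using region_near[of x] by blast
  then obtain z where z: "z \<in> region \<sigma>" by blast
  have "region \<sigma> \<in> components (- \<Union> (hypersurface ` I))"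
    using region_eq_connected_component[OF \<sigma>(1) z] z region_disjoint[OF \<sigma>(1)]
    by (auto simp: components_def image_iff)
  moreover have "carrier_cell x face_of closure (region \<sigma>)"
    using carrier_cell_face[OF \<sigma>(1,3)] closure_region[OF z] by simp
  moreover have "x \<in> carrier_cell x" by (auto simp: carrier_cell_def)
  ultimately show "x \<in> \<Union> {G \<in> induced_subdivision (hypersurface ` I). bounded G}"
    using x by (auto simp: induced_subdivision_def)
qed

end

section \<open>Graphical zonotopes\<close>

lemma compact_sum_segments:
  fixes f g :: "'p \<Rightarrow> 'a::euclidean_space"
  assumes "finite E"
  shows "compact (\<Sum>p\<in>E. (*\<^sub>R) (w p) ` closed_segment (f p) (g p))"
  using assms
proof (induction E rule: finite_induct)
  case (insert p E)
  have "S + T = {x + y | x y. x \<in> S \<and> y \<in> T}" for S T :: "'a set"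
    by (auto simp: set_plus_def)
  then have plus: "compact (S + T)" if "compact S" "compact T" for S T :: "'a set"
    using compact_sums[OF that] by simp
  show ?case
    unfolding sum.insert[OF insert.hyps]
    by (intro plus insert.IH compact_scaling compact_segment)
qed simp

text \<open>The minimum of a linear functional over a Minkowski sum is the sum of the minima over
  the segments, each attained at an endpoint. A compact convex set is determined by these minima
  through separating hyperplanes.\<close>

lemma mem_sum_segments_iff:
  fixes f g :: "'p \<Rightarrow> 'a::euclidean_space"
  assumes E: "finite E" and w: "\<And>p. p \<in> E \<Longrightarrow> 0 \<le> w p"
  shows "y \<in> (\<Sum>p\<in>E. (*\<^sub>R) (w p) ` closed_segment (f p) (g p)) \<longleftrightarrow>
    (\<forall>u. (\<Sum>p\<in>E. w p * min (u \<bullet> f p) (u \<bullet> g p)) \<le> u \<bullet> y)" (is "y \<in> ?Z \<longleftrightarrow> ?R")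
proof
  assume "y \<in> ?Z"
  then obtain z where z: "y = sum z E" "\<And>p. p \<in> E \<Longrightarrow> z p \<in> (*\<^sub>R) (w p) ` closed_segment (f p) (g p)"
    unfolding set_sum_alt[OF E] by blast
  show ?R
  proof
    fix u
    have "w p * min (u \<bullet> f p) (u \<bullet> g p) \<le> u \<bullet> z p" if p: "p \<in> E" for p
    proof -
      obtain l where l: "0 \<le> l" "l \<le> 1" "z p = w p *\<^sub>R ((1 - l) *\<^sub>R f p + l *\<^sub>R g p)"
        using z(2)[OF p] by (auto simp: in_segment)
      have "min (u \<bullet> f p) (u \<bullet> g p) =
          (1 - l) * min (u \<bullet> f p) (u \<bullet> g p) + l * min (u \<bullet> f p) (u \<bullet> g p)"
        by (simp add: algebra_simps)
      also have "\<dots> \<le> (1 - l) * (u \<bullet> f p) + l * (u \<bullet> g p)"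
        using l by (intro add_mono mult_left_mono) auto
      finally show ?thesis
        using w[OF p] l by (simp add: inner_add_right mult_left_mono)
    qed
    then show "(\<Sum>p\<in>E. w p * min (u \<bullet> f p) (u \<bullet> g p)) \<le> u \<bullet> y"
      by (simp add: z(1) inner_sum_right sum_mono)
  qed
next
  assume R: ?R
  have compact: "compact ?Z" using E by (rule compact_sum_segments)
  have convex: "convex ?Z"
    by (intro convex_set_sum convex_scaling convex_closed_segment)
  show "y \<in> ?Z"
  proof (rule ccontr)
    assume y: "y \<notin> ?Z"
    obtain u c where u: "u \<bullet> y < c" "\<And>z. z \<in> ?Z \<Longrightarrow> c < u \<bullet> z"
      using separating_hyperplane_closed_point[OF convex compact_imp_closed[OF compact] y] by blast
    \<comment> \<open>The endpoints minimizing \<open>u\<close> add up to a point of the sum where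
      the separating functional violates the hypothesis.\<close>
    define m where "m p = (if u \<bullet> f p \<le> u \<bullet> g p then f p else g p)" for p
    have "(\<Sum>p\<in>E. w p *\<^sub>R m p) \<in> ?Z"
      unfolding set_sum_alt[OF E] by (auto simp: m_def intro!: exI[of _ "\<lambda>p. w p *\<^sub>R m p"])
    then have "c < u \<bullet> (\<Sum>p\<in>E. w p *\<^sub>R m p)" using u by blast
    also have "\<dots> = (\<Sum>p\<in>E. w p * min (u \<bullet> f p) (u \<bullet> g p))"
      by (auto simp: inner_sum_right m_def min_def intro!: sum.cong)
    also have "\<dots> \<le> u \<bullet> y" using R by blast
    finally show False using u(1) by simp
  qed
qed

text \<open>Induction on the number of values of \<open>u\<close>: lowering the largest value to the second
  largest one uses only the hypothesis for the set where the largest value is attained.\<close>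

lemma Lovasz_extension_le:
  fixes y u :: "'v \<Rightarrow> real" and w :: "'v \<times> 'v \<Rightarrow> real"
  assumes V: "finite V" and E: "finite E" "E \<subseteq> V \<times> V"
    and le: "\<And>A. A \<subseteq> V \<Longrightarrow> (\<Sum>p\<in>E. w p * of_bool (fst p \<in> A \<and> snd p \<in> A)) \<le> sum y A"
    and eq: "(\<Sum>p\<in>E. w p) = sum y V"
  shows "(\<Sum>p\<in>E. w p * min (u (fst p)) (u (snd p))) \<le> (\<Sum>v\<in>V. u v * y v)"
proof (induction "card (u ` V)" arbitrary: u rule: less_induct)
  case less
  show ?case
  \<comment> \<open>For constant \<open>u\<close> the value may have either sign, so this case rests
    on the equality \<open>eq\<close>.\<close>
  proof (cases "card (u ` V) \<le> 1")
    case True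
    then obtain c where c: "\<And>v. v \<in> V \<Longrightarrow> u v = c"
      using V by (metis One_nat_def card_le_Suc0_iff_eq finite_imageI imageI)
    have "(\<Sum>p\<in>E. w p * min (u (fst p)) (u (snd p))) = (\<Sum>p\<in>E. c * w p)"
      using E c by (intro sum.cong) (auto dest!: subsetD)
    also have "\<dots> = (\<Sum>v\<in>V. u v * y v)"
      using eq c by (simp flip: sum_distrib_left)
    finally show ?thesis by simp
  next
    case False
    define m where "m = Max (u ` V)"
    define m' where "m' = Max (u ` V - {m})"
    have ne: "u ` V - {m} \<noteq> {}"
    proof
      assume "u ` V - {m} = {}"
      then have "card (u ` V) \<le> card {m}" by (intro card_mono) auto
      then show False using False by simp
    qed
    have m: "m \<in> u ` V" "\<And>v. v \<in> V \<Longrightarrow> u v \<le> m"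
      unfolding m_def using V ne by (auto intro!: Max_in)
    have m': "m' \<in> u ` V - {m}" "\<And>v. v \<in> V \<Longrightarrow> u v \<noteq> m \<Longrightarrow> u v \<le> m'"
      unfolding m'_def using V ne Max_in[of "u ` V - {m}"] by (blast, auto)
    have mm: "m' < m" using m m' by force
    define A where "A = {v \<in> V. u v = m}"
    define u' where "u' v = (if v \<in> A then m' else u v)" for v
    have "u' ` V \<subset> u ` V"
    proof
      show "u' ` V \<subseteq> u ` V" using m'(1) by (auto simp: u'_def)
      have "m \<notin> u' ` V" using mm by (auto simp: u'_def A_def)
      then show "u' ` V \<noteq> u ` V" using m(1) by blast
    qed
    then have IH: "(\<Sum>p\<in>E. w p * min (u' (fst p)) (u' (snd p))) \<le> (\<Sum>v\<in>V. u' v * y v)"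
      using V by (intro less psubset_card_mono) auto
    have "(\<Sum>p\<in>E. w p * min (u (fst p)) (u (snd p))) = (\<Sum>p\<in>E. w p * min (u' (fst p)) (u' (snd p)) +
        (m - m') * (w p * of_bool (fst p \<in> A \<and> snd p \<in> A)))"
    proof (intro sum.cong refl)
      fix p assume "p \<in> E"
      then have p: "fst p \<in> V" "snd p \<in> V" using E by auto
      \<comment> \<open>Lowering \<open>u\<close> on \<open>A\<close> from \<open>m\<close> to
        \<open>m'\<close> changes the minimum only if both ends lie in \<open>A\<close>, because
        every value outside \<open>A\<close> is at most \<open>m'\<close>.\<close>
      have eq: "min (u (fst p)) (u (snd p)) =
          min (u' (fst p)) (u' (snd p)) + (m - m') * of_bool (fst p \<in> A \<and> snd p \<in> A)"
        using m(2)[OF p(1)] m(2)[OF p(2)] m'(2)[OF p(1)] m'(2)[OF p(2)] mm p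
        by (auto simp: u'_def A_def min_def)
      show "w p * min (u (fst p)) (u (snd p)) = w p * min (u' (fst p)) (u' (snd p)) +
          (m - m') * (w p * of_bool (fst p \<in> A \<and> snd p \<in> A))"
        unfolding eq by (simp only: distrib_left mult.left_commute)
    qed
    also have "\<dots> \<le> (\<Sum>v\<in>V. u' v * y v) + (m - m') * sum y A"
      unfolding sum.distrib sum_distrib_left[symmetric]
      using mm by (intro add_mono IH mult_left_mono le) (auto simp: A_def)
    also have "(m - m') * sum y A = (\<Sum>v\<in>V. of_bool (v \<in> A) * (m - m') * y v)"
      unfolding sum_distrib_left using V by (intro sum.mono_neutral_cong_left) (auto simp: A_def)
    also have "(\<Sum>v\<in>V. u' v * y v) + \<dots> = (\<Sum>v\<in>V. u v * y v)"
      unfolding sum.distrib[symmetric] by (intro sum.cong) (auto simp: u'_def A_def algebra_simps)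
    finally show ?thesis .
  qed
qed

text \<open>The right-hand side describes the base polytope of the supermodular function sending
  \<open>A\<close> to the total weight of the pairs inside \<open>A\<close>. Indicator vectors as
  test functionals give these conditions, and the Lovasz extension recovers all other
  functionals.\<close>

lemma mem_graphical_zonotope_iff:
  fixes e :: "'v \<Rightarrow> 'a::euclidean_space"
  assumes V: "finite V" and E: "finite E" "E \<subseteq> V \<times> V" and w: "\<And>p. p \<in> E \<Longrightarrow> 0 \<le> w p"
    and e: "bij_betw e V Basis"
  shows "y \<in> (\<Sum>p\<in>E. (*\<^sub>R) (w p) ` closed_segment (e (fst p)) (e (snd p))) \<longleftrightarrow>
    (\<forall>A\<subseteq>V. (\<Sum>p\<in>E. w p * of_bool (fst p \<in> A \<and> snd p \<in> A)) \<le> (\<Sum>v\<in>A. y \<bullet> e v)) \<and>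
    (\<Sum>p\<in>E. w p) = (\<Sum>v\<in>V. y \<bullet> e v)" (is "_ \<longleftrightarrow> ?L \<and> ?T")
proof -
  have ee: "e v \<bullet> e v' = of_bool (v = v')" if "v \<in> V" "v' \<in> V" for v v'
  proof -
    have "e v \<in> Basis" "e v' \<in> Basis" "e v = e v' \<longleftrightarrow> v = v'"
      using that e by (auto simp: bij_betw_def inj_on_def)
    then show ?thesis by (simp add: inner_Basis)
  qed
  have indicator: "(\<Sum>v\<in>A. e v) \<bullet> e v' = of_bool (v' \<in> A)" if "A \<subseteq> V" "v' \<in> V" for A v'
  proof -
    have "(\<Sum>v\<in>A. e v) \<bullet> e v' = (\<Sum>v\<in>A. if v = v' then 1 else 0)"
      unfolding inner_sum_left using that ee by (intro sum.cong) auto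
    also have "\<dots> = of_bool (v' \<in> A)" using finite_subset[OF that(1) V] by simp
    finally show ?thesis .
  qed
  have inner_y: "(\<Sum>v\<in>A. e v) \<bullet> y = (\<Sum>v\<in>A. y \<bullet> e v)" for A
    unfolding inner_sum_left by (intro sum.cong refl inner_commute)
  have EV: "fst p \<in> V" "snd p \<in> V" if "p \<in> E" for p using that E by auto
  have "(\<forall>u. (\<Sum>p\<in>E. w p * min (u \<bullet> e (fst p)) (u \<bullet> e (snd p))) \<le> u \<bullet> y) \<longleftrightarrow> ?L \<and> ?T"
  proof (intro iffI conjI)
    assume *: "\<forall>u. (\<Sum>p\<in>E. w p * min (u \<bullet> e (fst p)) (u \<bullet> e (snd p))) \<le> u \<bullet> y"
    show L: ?L
    proof (intro allI impI)
      fix A assume A: "A \<subseteq> V"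
      have "(\<Sum>p\<in>E. w p * of_bool (fst p \<in> A \<and> snd p \<in> A)) =
          (\<Sum>p\<in>E. w p * min ((\<Sum>v\<in>A. e v) \<bullet> e (fst p)) ((\<Sum>v\<in>A. e v) \<bullet> e (snd p)))"
        using A EV by (intro sum.cong) (auto simp: indicator)
      also have "\<dots> \<le> (\<Sum>v\<in>A. e v) \<bullet> y" using * by blast
      finally show "(\<Sum>p\<in>E. w p * of_bool (fst p \<in> A \<and> snd p \<in> A)) \<le> (\<Sum>v\<in>A. y \<bullet> e v)"
        by (simp only: inner_y)
    qed
    \<comment> \<open>The negative of the all-ones functional supplies the reverse inequality for
      \<open>V\<close>.\<close>
    have "(\<Sum>p\<in>E. - w p) =
        (\<Sum>p\<in>E. w p * min ((- (\<Sum>v\<in>V. e v)) \<bullet> e (fst p)) ((- (\<Sum>v\<in>V. e v)) \<bullet> e (snd p)))"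
      using EV by (intro sum.cong) (auto simp: indicator)
    also have "\<dots> \<le> (- (\<Sum>v\<in>V. e v)) \<bullet> y" using * by blast
    finally have "(\<Sum>v\<in>V. y \<bullet> e v) \<le> (\<Sum>p\<in>E. w p)"
      by (simp add: inner_y sum_negf)
    moreover have "(\<Sum>p\<in>E. w p) = (\<Sum>p\<in>E. w p * of_bool (fst p \<in> V \<and> snd p \<in> V))"
      using EV by (intro sum.cong) auto
    ultimately show ?T using L[rule_format, of V] by simp
  next
    assume LT: "?L \<and> ?T"
    show "\<forall>u. (\<Sum>p\<in>E. w p * min (u \<bullet> e (fst p)) (u \<bullet> e (snd p))) \<le> u \<bullet> y"
    proof
      fix u
      have "(\<Sum>p\<in>E. w p * min (u \<bullet> e (fst p)) (u \<bullet> e (snd p))) \<le>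
          (\<Sum>v\<in>V. (u \<bullet> e v) * (y \<bullet> e v))"
        using LT Lovasz_extension_le[OF V E, of w "\<lambda>v. y \<bullet> e v" "\<lambda>v. u \<bullet> e v"] by blast
      also have "\<dots> = (\<Sum>b\<in>Basis. (u \<bullet> b) * (y \<bullet> b))"
        by (rule sum.reindex_bij_betw[OF e])
      also have "\<dots> = u \<bullet> y" by (rule euclidean_inner[symmetric])
      finally show "(\<Sum>p\<in>E. w p * min (u \<bullet> e (fst p)) (u \<bullet> e (snd p))) \<le> u \<bullet> y" .
    qed
  qed
  then show ?thesis
    using mem_sum_segments_iff[OF E(1), of w y "\<lambda>p. e (fst p)" "\<lambda>p. e (snd p)", OF w] by blast
qed

section \<open>Coherence and lower faces\<close>

lemma part_pos: "composition s \<Longrightarrow> 1 \<le> c \<Longrightarrow> c \<le> length s + 1 \<Longrightarrow> 0 < part s c"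
  by (auto simp: composition_def part_def nth_append)

lemma part_last: "part s (length s + 1) = 2"
  by (simp add: part_def)

lemma level_top [simp]: "level s (k, t, \<delta>) k = t"
  by (simp add: level_def)

lemma level_below: "c < k \<Longrightarrow> level s (k, t, \<delta>) c = \<delta> c * part s c"
  by (simp add: level_def)

lemma cube_cases: "\<delta> \<in> cube m \<Longrightarrow> 1 \<le> i \<Longrightarrow> i \<le> m \<Longrightarrow> \<delta> i = 0 \<or> \<delta> i = 1"
  by (auto simp: cube_def)

text \<open>Upper indices decrease along a route. The middle piece, strictly between
  \<open>c\<close> and \<open>j\<close>, will be the common subpath in
  \<open>coherent\<close>.\<close>

lemma route_path_split:
  assumes "1 \<le> j" "j < c" "c \<le> fst R"
  shows "route_path s R = map (\<lambda>c. (c, level s R c)) (rev [c..<Suc (fst R)]) @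
    map (\<lambda>c. (c, level s R c)) (rev [Suc j..<c]) @ map (\<lambda>c. (c, level s R c)) (rev [1..<Suc j])"
proof -
  have "[1..<Suc (fst R)] = [1..<c] @ [c..<Suc (fst R)]"
    using assms upt_add_eq_append[of 1 c "Suc (fst R) - c"] by simp
  moreover have "[1..<c] = [1..<Suc j] @ [Suc j..<c]"
    using assms upt_add_eq_append[of 1 "Suc j" "c - Suc j"] by simp
  ultimately show ?thesis by (simp add: route_path_def del: upt_Suc)
qed

text \<open>Below its top index a route uses only bumps and dips, whose tail is not the
  source.\<close>

lemma tail_level:
  assumes "composition s" "R \<in> routes s" "1 \<le> j" "j < fst R"
  shows "tail s (j, level s R j) = int (length s) - int j"
proof -
  obtain k t \<delta> where R: "R = (k, t, \<delta>)" by (cases R)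
  have "\<delta> j = 0 \<or> \<delta> j = 1"
    using assms R by (intro cube_cases[of _ "k - 1"]) (auto simp: routes_def)
  moreover have "0 < part s j" using assms R by (intro part_pos) (auto simp: routes_def)
  ultimately show ?thesis using assms R by (auto simp: tail_def level_below)
qed

text \<open>Were the order reversed at \<open>i\<close>, there would be adjacent strict comparisons
  of opposite sense with equal levels in between. These delimit a maximal common subpath that is
  entered in one order and left in the other, contradicting coherence.\<close>

lemma coherent_level_mono:
  assumes s: "composition s" and PQ: "P \<in> routes s" "Q \<in> routes s" and coh: "coherent s P Q"
    and i: "1 \<le> i" "i < c" and c: "c \<le> fst P" "c \<le> fst Q"
    and less: "level s P c < level s Q c"
  shows "level s P i \<le> level s Q i"
proof (rule ccontr)
  assume gt: "\<not> level s P i \<le> level s Q i"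
  define J where "J = {j \<in> {i..<c}. level s Q j < level s P j}"
  define j where "j = Max J"
  have "j \<in> J" unfolding j_def using gt i by (intro Max_in) (auto simp: J_def)
  then have j: "i \<le> j" "j < c" "level s Q j < level s P j" by (auto simp: J_def)
  have j_max: "\<not> level s Q l < level s P l" if "j < l" "l < c" for l
  proof
    assume "level s Q l < level s P l"
    then have "l \<le> j" unfolding j_def using that i j by (intro Max_ge) (auto simp: J_def)
    then show False using that by simp
  qed
  \<comment> \<open>\<open>j\<close> is the last reversal below \<open>c\<close>, and
    \<open>d\<close> the first index above it with the original strict order; the choice of both
    makes the levels between them equal.\<close>
  define d where "d = (LEAST d. j < d \<and> level s P d < level s Q d)"
  have d: "j < d" "level s P d < level s Q d"
    using LeastI[of "\<lambda>d. j < d \<and> level s P d < level s Q d" c] j less by (auto simp: d_def)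
  have d_min: "d \<le> l" if "j < l" "level s P l < level s Q l" for l
    using that Least_le[of "\<lambda>d. j < d \<and> level s P d < level s Q d" l] by (auto simp: d_def)
  have dc: "d \<le> c" using d_min j less by blast
  have eq: "level s P l = level s Q l" if "j < l" "l < d" for l
  proof -
    have "\<not> level s P l < level s Q l" using d_min[of l] that by linarith
    moreover have "\<not> level s Q l < level s P l" using j_max[of l] that dc by linarith
    ultimately show ?thesis by linarith
  qed
  let ?e = "\<lambda>R c. (c, level s R c)"
  let ?before = "\<lambda>R. map (?e R) (rev [d..<Suc (fst R)])"
  let ?after = "\<lambda>R. map (?e R) (rev [1..<Suc j])"
  let ?M = "map (?e P) (rev [Suc j..<d])"
  have "?M = map (?e Q) (rev [Suc j..<d])" using eq by simp
  then have split: "route_path s P = ?before P @ ?M @ ?after P"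
      "route_path s Q = ?before Q @ ?M @ ?after Q"
    using route_path_split[of j d P] route_path_split[of j d Q] i j d dc c
    by (auto simp del: upt_Suc)
  have last: "last (?before R) = ?e R d" "?before R \<noteq> []" if "d \<le> fst R" for R
    using that by (auto simp: last_map last_rev hd_map simp del: upt_Suc)
  have hd: "hd (?after R) = ?e R j" "?after R \<noteq> []" for R
    using i j by auto
  have dPQ: "d \<le> fst P" "d \<le> fst Q" using dc c by auto
  have "head s (?e P d) = head s (?e Q d)" by (simp add: head_def)
  moreover have "tail s (?e P j) = tail s (?e Q j)"
    using s PQ i j c by (simp add: tail_level)
  moreover have "?e P d \<noteq> ?e Q d" "?e P j \<noteq> ?e Q j" using d j by auto
  ultimately have "framing_less (?e P d) (?e Q d) \<longleftrightarrow> framing_less (?e P j) (?e Q j)"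
    using coh[unfolded coherent_def, rule_format,
        of "?before P" ?M "?after P" "?before Q" "?after Q"]
      split last[OF dPQ(1)] last[OF dPQ(2)] hd[of P] hd[of Q]
    by (simp only: simp_thms)
  then show False using d j by (simp add: framing_less_def)
qed

section \<open>Route vectors and linear functionals on flows\<close>

lemma lookup_scaleR:
  "Poly_Mapping.lookup (r *\<^sub>R v) i = r *\<^sub>R Poly_Mapping.lookup (v :: 'a \<Rightarrow>\<^sub>0 'b::real_vector) i"
proof -
  have "finite {i. r *\<^sub>R Poly_Mapping.lookup v i \<noteq> 0}"
    by (rule finite_subset[OF _ finite_lookup[of v]]) auto
  then show ?thesis by (simp add: scaleR_poly_mapping_def Abs_poly_mapping_inverse)
qed

lemma linear_lookup_sum:
  "linear (\<lambda>v :: 'a \<Rightarrow>\<^sub>0 real. \<Sum>e\<in>E. c e * Poly_Mapping.lookup v e)"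
  by (rule linearI)
    (simp_all add: lookup_add lookup_scaleR sum.distrib sum_distrib_left algebra_simps)

lemma lookup_route_vector:
  "Poly_Mapping.lookup (route_vector s R) e = of_bool (e \<in> set (route_path s R))"
  by (simp add: route_vector_def lookup_sum lookup_single when_def)

lemma set_route_path: "set (route_path s R) = (\<lambda>c. (c, level s R c)) ` {1..fst R}"
  by (auto simp: route_path_def)

lemma set_route_path_subset: "R \<in> routes s \<Longrightarrow> set (route_path s R) \<subseteq> edges s"
  using source_sink_path_iff[of s] by (auto simp: source_sink_path_def)

lemma finite_edges: "finite (edges s)"
proof -
  have "edges s = (SIGMA i:{1..length s + 1}. {1..part s i - 1}) \<union>
      (SIGMA i:{1..length s}. {0, part s i})"
    by (auto simp: edges_def)
  then show ?thesis by simp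
qed

text \<open>Evaluates the functional with edge costs \<open>c\<close> at a route: its value is the
  total cost of the path.\<close>

lemma sum_lookup_route_vector:
  assumes "R \<in> routes s"
  shows "(\<Sum>e\<in>edges s. c e * Poly_Mapping.lookup (route_vector s R) e) =
    (\<Sum>i=1..fst R. c (i, level s R i))"
proof -
  have "(\<Sum>e\<in>edges s. c e * Poly_Mapping.lookup (route_vector s R) e) =
      (\<Sum>e\<in>set (route_path s R). c e)"
    using set_route_path_subset[OF assms] finite_edges
    by (intro sum.mono_neutral_cong_right) (auto simp: lookup_route_vector)
  also have "\<dots> = (\<Sum>i=1..fst R. c (i, level s R i))"
    unfolding set_route_path by (subst sum.reindex) (auto simp: inj_on_def)
  finally show ?thesis .
qed

text \<open>Each upper index occurs once on a path, in a fixed order, so the set of edges determines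
  the list.\<close>

lemma route_path_eqI:
  assumes "set (route_path s P) = set (route_path s Q)"
  shows "route_path s P = route_path s Q"
proof -
  have "fst ` set (route_path s P) = fst ` set (route_path s Q)" using assms by simp
  then have "{1..fst P} = {1..fst Q}" by (simp add: set_route_path image_image)
  then have k: "fst P = fst Q" by (metis card_atLeastAtMost diff_Suc_1)
  have "level s P c = level s Q c" if "c \<in> {1..fst P}" for c
  proof -
    have "(c, level s P c) \<in> set (route_path s Q)"
      using that unfolding assms[symmetric] by (auto simp: set_route_path)
    then show ?thesis by (auto simp: set_route_path)
  qed
  then show ?thesis unfolding route_path_def k[symmetric] by (intro map_cong) auto
qed

text \<open>A route vector is a vertex of the unit cube: the functional that counts the edges on the
  path of \<open>R\<close> and subtracts those off it is maximal only at \<open>R\<close>.\<close>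

lemma route_vector_in_hull:
  assumes R: "R \<in> routes s" and C: "C \<subseteq> routes s"
    and hull: "route_vector s R \<in> convex hull (route_vector s ` C)"
  shows "\<exists>Q\<in>C. route_path s Q = route_path s R"
proof (rule ccontr)
  assume no: "\<not> ?thesis"
  define c :: "edge \<Rightarrow> real" where "c e = (if e \<in> set (route_path s R) then 1 else -1)" for e
  define \<psi> where "\<psi> v = (\<Sum>e\<in>edges s. c e * Poly_Mapping.lookup v e)" for v
  have lin: "linear \<psi>" unfolding \<psi>_def by (rule linear_lookup_sum)
  have E: "finite (edges s)" by (rule finite_edges)
  have "\<psi> (route_vector s Q) < \<psi> (route_vector s R)" if Q: "Q \<in> C" for Q
  proof -
    have "set (route_path s Q) \<noteq> set (route_path s R)" using no Q route_path_eqI by blast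
    then obtain e where e: "e \<in> edges s"
        "e \<in> set (route_path s Q) \<longleftrightarrow> e \<notin> set (route_path s R)"
      using set_route_path_subset[OF R] set_route_path_subset[of Q s] C Q by blast
    show ?thesis
      unfolding \<psi>_def by (rule sum_strict_mono_ex1[OF E]) (use e in \<open>auto simp: lookup_route_vector c_def\<close>)
  qed
  then have "route_vector s ` C \<subseteq> \<psi> -` {..<\<psi> (route_vector s R)}" by auto
  then have "convex hull (route_vector s ` C) \<subseteq> \<psi> -` {..<\<psi> (route_vector s R)}"
    by (rule hull_minimal) (intro convex_linear_vimage lin convex_real_interval)
  then show False using hull by auto
qed

text \<open>Lifted routes of height 0 lie on one lower face, whose projection is the hull of a
  coherent set \<open>C\<close>. Route vectors in that hull come from paths of members of
  \<open>C\<close>.\<close>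

lemma admissible_coherent:
  assumes adm: "admissible s h" and lin: "linear l"
    and nonneg: "\<And>R. R \<in> routes s \<Longrightarrow> 0 \<le> l (route_vector s R) + h R"
    and P: "P \<in> routes s" "l (route_vector s P) + h P = 0"
    and Q: "Q \<in> routes s" "l (route_vector s Q) + h Q = 0"
  shows "coherent s P Q"
proof -
  define L where "L = lifted_polytope s h"
  have "linear (\<lambda>p. l (fst p) + snd p)"
    by (intro linear_compose_add linear_compose[OF linear_fst lin, unfolded o_def] linear_snd)
  then have "convex ((\<lambda>p. l (fst p) + snd p) -` {0..})"
    by (intro convex_linear_vimage convex_real_interval)
  then have L: "L \<subseteq> (\<lambda>p. l (fst p) + snd p) -` {0..}"
    unfolding L_def lifted_polytope_def using nonneg by (intro hull_minimal) auto
  define F where "F = {p\<in>L. \<forall>q\<in>L. l (fst p) + snd p \<le> l (fst q) + snd q}"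
  have "fst ` F \<in> DKK_triangulation s"
    using adm lin unfolding admissible_def lower_faces_def F_def L_def by blast
  then obtain C where C: "fst ` F = convex hull (route_vector s ` C)" "C \<subseteq> routes s"
      "\<forall>P\<in>C. \<forall>Q\<in>C. coherent s P Q"
    unfolding DKK_triangulation_def by blast
  have "\<exists>R'\<in>C. route_path s R' = route_path s R"
    if R: "R \<in> routes s" "l (route_vector s R) + h R = 0" for R
  proof -
    have "(route_vector s R, h R) \<in> L"
      unfolding L_def lifted_polytope_def using R by (intro hull_inc) auto
    then have "(route_vector s R, h R) \<in> F" unfolding F_def using L R by auto
    then have "route_vector s R \<in> fst ` F" by force
    then show ?thesis using route_vector_in_hull R C by metis
  qed
  then obtain P' Q' where "P' \<in> C" "Q' \<in> C" "route_path s P' = route_path s P"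
      "route_path s Q' = route_path s Q"
    using P Q by metis
  \<comment> \<open>Equality of paths suffices, since \<open>coherent\<close> reads routes only
    through \<open>route_path\<close>.\<close>
  then show ?thesis using C(3) unfolding coherent_def by metis
qed

section \<open>The union of the bounded cells\<close>

lemma ix_bij_betw:
  assumes "n = CARD('n::{finite,linorder})"
  shows "bij_betw (ix :: nat \<Rightarrow> 'n) {1..n} UNIV"
proof -
  have "bij_betw (\<lambda>i. sorted_list_of_set (UNIV :: 'n set) ! i) {..<n} UNIV"
    using assms by (intro bij_betw_nth) auto
  moreover have "bij_betw (\<lambda>i. i - 1) {1..n} {..<n}"
    by (rule bij_betw_byWitness[where f' = Suc]) auto
  moreover have "(ix :: nat \<Rightarrow> 'n) = (\<lambda>i. sorted_list_of_set (UNIV :: 'n set) ! i) \<circ> (\<lambda>i. i - 1)"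
    by (simp add: fun_eq_iff ix_def)
  ultimately show ?thesis using bij_betw_trans by metis
qed

lemma axis_ix_bij_betw:
  assumes "n = CARD('n::{finite,linorder})"
  shows "bij_betw (\<lambda>i. axis (ix i :: 'n) (1::real)) {1..n} Basis"
proof -
  have "bij_betw (\<lambda>j. axis (j::'n) (1::real)) UNIV Basis"
    by (auto simp: bij_betw_def inj_on_def axis_eq_axis Basis_vec_def)
  then show ?thesis using bij_betw_trans[OF ix_bij_betw[OF assms]] by (simp add: o_def)
qed

section \<open>The tropical arrangement as an affine family\<close>

definition trop_gradient :: "nat \<Rightarrow> (nat \<Rightarrow> nat) \<Rightarrow> real ^ 'n::{finite,linorder}" where
  "trop_gradient k \<delta> = (\<Sum>i=1..<k. real (\<delta> i) *\<^sub>R axis (ix i) 1)"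

definition trop_minimizers ::
    "(route \<Rightarrow> real) \<Rightarrow> nat \<Rightarrow> nat \<Rightarrow> real ^ 'n::{finite,linorder} \<Rightarrow> (nat \<Rightarrow> nat) set" where
  "trop_minimizers h k t x =
     {\<delta> \<in> cube (k - 1). \<forall>\<delta>'\<in>cube (k - 1). trop_term h k t x \<delta> \<le> trop_term h k t x \<delta>'}"

definition trop_index :: "nat list \<Rightarrow> (nat \<times> nat) set" where
  "trop_index s = (SIGMA k:{2..length s + 1}. {1..part s k - 1})"

text \<open>The carrier cell of \<open>affine_family\<close>, specialized to the tropical
  polynomials.\<close>

definition trop_cell ::
    "nat list \<Rightarrow> (route \<Rightarrow> real) \<Rightarrow> real ^ 'n::{finite,linorder} \<Rightarrow> (real ^ 'n::{finite,linorder}) set" where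
  "trop_cell s h x =
     {y. \<forall>(k, t)\<in>trop_index s. trop_minimizers h k t x \<subseteq> trop_minimizers h k t y}"

lemma trop_term_gradient: "trop_term h k t x \<delta> = h (k, t, \<delta>) + trop_gradient k \<delta> \<bullet> x"
  by (simp add: trop_term_def trop_gradient_def inner_sum_left inner_axis' )

lemma trop_gradient_axis:
  fixes \<delta> :: "nat \<Rightarrow> nat"
  assumes "n = CARD('n::{finite,linorder})" "i \<in> {1..n}" "k \<le> n + 1"
  shows "trop_gradient k \<delta> \<bullet> (axis (ix i) 1 :: real ^ 'n::{finite,linorder}) = (if i < k then real (\<delta> i) else 0)"
proof -
  have inj: "inj_on (ix :: nat \<Rightarrow> 'n) {1..n}" using ix_bij_betw[OF assms(1)] by (rule bij_betw_imp_inj_on)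
  have "axis (ix j :: 'n) (1::real) \<bullet> axis (ix i) 1 = of_bool (i = j)" if "j \<in> {1..<k}" for j
  proof -
    have "j \<in> {1..n}" using that assms(3) by auto
    then have "(ix j :: 'n) = ix i \<longleftrightarrow> j = i" using inj_on_eq_iff[OF inj] assms(2) by blast
    then show ?thesis by (auto simp: inner_axis_axis)
  qed
  then have "trop_gradient k \<delta> \<bullet> (axis (ix i) 1 :: (real, 'n) vec) =
      (\<Sum>j=1..<k. if i = j then real (\<delta> j) else 0)"
    unfolding trop_gradient_def inner_sum_left by (intro sum.cong) auto
  also have "\<dots> = (if i < k then real (\<delta> i) else 0)" using assms(2) by simp
  finally show ?thesis .
qed

lemma finite_cube: "finite (cube m)"
  by (simp add: cube_def finite_PiE)

lemma cube_nonempty: "cube m \<noteq> {}"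
  by (auto simp: cube_def PiE_eq_empty_iff)

lemma cube_eqI:
  assumes "\<delta> \<in> cube m" "\<delta>' \<in> cube m" "\<And>i. i \<in> {1..m} \<Longrightarrow> \<delta> i = \<delta>' i"
  shows "\<delta> = \<delta>'"
  using assms unfolding cube_def by (rule PiE_ext)

lemma trop_poly_le: "\<delta> \<in> cube (k - 1) \<Longrightarrow> trop_poly h k t x \<le> trop_term h k t x \<delta>"
  unfolding trop_poly_def by (intro Min_le finite_imageI finite_cube imageI)

lemma trop_minimizers_eq:
  "trop_minimizers h k t x = {\<delta> \<in> cube (k - 1). trop_term h k t x \<delta> = trop_poly h k t x}"
proof -
  have "trop_poly h k t x \<in> trop_term h k t x ` cube (k - 1)"
    unfolding trop_poly_def by (intro Min_in finite_imageI finite_cube) (simp add: cube_nonempty)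
  then obtain \<gamma> where \<gamma>: "\<gamma> \<in> cube (k - 1)" "trop_poly h k t x = trop_term h k t x \<gamma>" by blast
  have "trop_term h k t x \<delta> = trop_poly h k t x"
    if "\<delta> \<in> trop_minimizers h k t x" for \<delta>
    using that \<gamma> trop_poly_le[of \<delta> k h t x] by (auto simp: trop_minimizers_def intro: antisym)
  then show ?thesis using trop_poly_le[of _ k h t x] by (auto simp: trop_minimizers_def)
qed

text \<open>Interprets \<open>affine_family\<close> with cube vertices as labels; the coordinates of
  a gradient recover its vertex, which gives \<open>inj_gradient\<close>.\<close>

lemma Union_Perm:
  assumes n: "length s = CARD('n::{finite,linorder})"
  shows "\<Union> (Perm s h) = {x :: real ^ 'n::{finite,linorder}. bounded (trop_cell s h x)}"
proof -
  define grad :: "nat \<times> nat \<Rightarrow> (nat \<Rightarrow> nat) \<Rightarrow> (real, 'n) vec"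
    where "grad p \<delta> = trop_gradient (fst p) \<delta>" for p \<delta>
  interpret affine_family "trop_index s" "\<lambda>(k, t). cube (k - 1)" "\<lambda>(k, t) \<delta>. h (k, t, \<delta>)" grad
  proof
    fix p assume "p \<in> trop_index s"
    then obtain k t where p: "p = (k, t)" "2 \<le> k" "k \<le> length s + 1"
      by (auto simp: trop_index_def)
    have "inj_on (trop_gradient k :: _ \<Rightarrow> (real, 'n) vec) (cube (k - 1))"
    proof (rule inj_onI)
      fix \<delta> \<delta>'
      assume *: "\<delta> \<in> cube (k - 1)" "\<delta>' \<in> cube (k - 1)"
        "(trop_gradient k \<delta> :: (real, 'n) vec) = trop_gradient k \<delta>'"
      show "\<delta> = \<delta>'"
      proof (rule cube_eqI[OF *(1,2)])
        fix i assume i: "i \<in> {1..k - 1}"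
        have "real (\<delta> i) = trop_gradient k \<delta> \<bullet> (axis (ix i) 1 :: (real, 'n) vec)"
          using trop_gradient_axis[OF n, of i k \<delta>] i p by auto
        also have "\<dots> = real (\<delta>' i)"
          using trop_gradient_axis[OF n, of i k \<delta>'] i p *(3) by auto
        finally show "\<delta> i = \<delta>' i" by simp
      qed
    qed
    then show "inj_on (grad p) (case p of (k, t) \<Rightarrow> cube (k - 1))"
      by (simp add: p grad_def[abs_def])
  qed (auto simp: trop_index_def finite_cube cube_nonempty)
  have min: "minimizers (k, t) x = trop_minimizers h k t x" for k t x
    unfolding minimizers_def trop_minimizers_def val_def grad_def trop_term_gradient by simp
  have "hypersurface (k, t) = trop_hypersurface h k t" for k t
    unfolding hypersurface_def trop_hypersurface_def min trop_minimizers_eq by blast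
  then have "hypersurface ` trop_index s = trop_arrangement s h"
    by (force simp: trop_arrangement_def trop_index_def)
  moreover have "carrier_cell x = trop_cell s h x" for x
  proof -
    have "minimizers p y = trop_minimizers h (fst p) (snd p) y" for p y
      by (cases p) (simp only: min fst_conv snd_conv)
    note eq = this
    show ?thesis unfolding carrier_cell_def trop_cell_def eq by (simp only: case_prod_unfold)
  qed
  ultimately show ?thesis using Union_bounded_cells by (simp add: Perm_def)
qed

text \<open>Otherwise the cell recedes in the direction of the \<open>i\<close>-th coordinate axis.\<close>

lemma both_values_occur:
  fixes x :: "real ^ 'n::{finite,linorder}"
  assumes n: "length s = CARD('n)" and bdd: "bounded (trop_cell s h x)"
    and i: "i \<in> {1..length s}" and v: "v \<in> {0, 1::nat}"
  shows "\<exists>k t. \<exists>\<delta>\<in>trop_minimizers h k t x. (k, t) \<in> trop_index s \<and> i < k \<and> \<delta> i = v"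
proof (rule ccontr)
  assume no: "\<not> ?thesis"
  \<comment> \<open>If the value 1 is missing at \<open>i\<close>, all minimizers involving that
    coordinate have value 0, so raising it never hurts them; if 0 is missing, lowering it does
    not.\<close>
  define \<sigma> :: real where "\<sigma> = (if v = 1 then 1 else -1)"
  have "x + (u * \<sigma>) *\<^sub>R axis (ix i) 1 \<in> trop_cell s h x" if u: "0 \<le> u" for u
  proof -
    have "\<delta> \<in> trop_minimizers h k t (x + (u * \<sigma>) *\<^sub>R axis (ix i) 1)"
      if kt: "(k, t) \<in> trop_index s" and \<delta>: "\<delta> \<in> trop_minimizers h k t x" for k t \<delta>
    proof -
      have k: "k \<le> length s + 1" using kt by (auto simp: trop_index_def)
      have shift: "trop_term h k t (x + (u * \<sigma>) *\<^sub>R axis (ix i) 1) \<gamma> =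
          trop_term h k t x \<gamma> + (u * \<sigma>) * (if i < k then real (\<gamma> i) else 0)" for \<gamma>
        using trop_gradient_axis[OF n i k, of \<gamma>] by (simp add: trop_term_gradient inner_add_right)
      have "(u * \<sigma>) * (if i < k then real (\<delta> i) else 0) \<le> (u * \<sigma>) * (if i < k then real (\<gamma> i) else 0)"
        if \<gamma>: "\<gamma> \<in> cube (k - 1)" for \<gamma>
      proof (cases "i < k")
        case True
        have "\<delta> \<in> cube (k - 1)" using \<delta> by (simp add: trop_minimizers_def)
        then have "\<delta> i = 0 \<or> \<delta> i = 1" "\<gamma> i = 0 \<or> \<gamma> i = 1"
          using \<gamma> True i cube_cases[of _ "k - 1" i] by auto
        moreover have "\<delta> i \<noteq> v" using no kt \<delta> True by blast
        ultimately show ?thesis using v u True by (auto simp: \<sigma>_def)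
      qed simp
      then show ?thesis
        using \<delta> by (auto simp: trop_minimizers_def shift intro!: add_mono)
    qed
    then show ?thesis by (auto simp: trop_cell_def)
  qed
  then have cell: "x + (u * \<sigma>) *\<^sub>R axis (ix i) 1 \<in> trop_cell s h x" if "0 \<le> u" for u
    using that by blast
  obtain r where r: "\<And>y. y \<in> trop_cell s h x \<Longrightarrow> norm y \<le> r"
    using bdd unfolding bounded_iff by blast
  define u where "u = norm x + \<bar>r\<bar> + 1"
  have "0 \<le> u" by (simp add: u_def)
  then have "norm (x + (u * \<sigma>) *\<^sub>R axis (ix i) 1) \<le> r" using r cell by blast
  moreover have "norm ((u * \<sigma>) *\<^sub>R axis (ix i) (1::real) :: (real, 'n) vec) = u"
    using \<open>0 \<le> u\<close> by (simp add: \<sigma>_def)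
  moreover have "norm ((u * \<sigma>) *\<^sub>R axis (ix i) (1::real) :: (real, 'n) vec) \<le>
      norm (x + (u * \<sigma>) *\<^sub>R axis (ix i) 1) + norm x"
    using norm_triangle_ineq4[of "x + (u * \<sigma>) *\<^sub>R axis (ix i) 1" x] by simp
  ultimately show False unfolding u_def by linarith
qed

lemma trop_index_routes:
  "(k, t) \<in> trop_index s \<Longrightarrow> \<delta> \<in> trop_minimizers h k t x \<Longrightarrow> (k, t, \<delta>) \<in> routes s"
  by (auto simp: routes_def trop_index_def trop_minimizers_def)

text \<open>The lower face is cut out by the functional that takes the value \<open>x\<^sub>i\<close> on the dip
  \<open>e\<^sup>i\<close>, vanishes on bumps, and subtracts the minimum \<open>F\<^sup>k\<^sub>t(x)\<close> on the source
  edge \<open>e\<^sup>k\<^sub>t\<close>.\<close>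

lemma minimizers_coherent:
  fixes x :: "real ^ 'n::{finite,linorder}"
  assumes s: "composition s" and adm: "admissible s h"
    and P: "(k, t) \<in> trop_index s" "\<delta> \<in> trop_minimizers h k t x"
    and Q: "(k', t') \<in> trop_index s" "\<delta>' \<in> trop_minimizers h k' t' x"
  shows "coherent s (k, t, \<delta>) (k', t', \<delta>')"
proof -
  \<comment> \<open>Source edges are tested first, so for \<open>part s i = 1\<close> the edge with
    \<open>j = 1\<close> counts as the dip. The upper index 1 is covered too: there
    \<open>trop_poly\<close> is the minimum over the one point of \<open>cube 0\<close>.\<close>
  define c :: "edge \<Rightarrow> real" where "c e = (case e of (i, j) \<Rightarrow>
    if 1 \<le> j \<and> j \<le> part s i - 1 then - trop_poly h i j x else if j = 0 then 0 else x $ ix i)" for e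
  define l where "l v = (\<Sum>e\<in>edges s. c e * Poly_Mapping.lookup v e)" for v
  have l: "l (route_vector s (k, t, \<delta>)) + h (k, t, \<delta>) = trop_term h k t x \<delta> - trop_poly h k t x"
    if R: "(k, t, \<delta>) \<in> routes s" for k t \<delta>
  proof -
    have k: "1 \<le> k" "k \<le> length s + 1" "1 \<le> t" "t \<le> part s k - 1" and \<delta>: "\<delta> \<in> cube (k - 1)"
      using R by (auto simp: routes_def)
    have "c (i, level s (k, t, \<delta>) i) = real (\<delta> i) * x $ ix i" if i: "i \<in> {1..<k}" for i
    proof -
      have "0 < part s i" using i k by (intro part_pos s) auto
      moreover have "\<delta> i = 0 \<or> \<delta> i = 1" using i \<delta> by (intro cube_cases[of _ "k - 1"]) auto
      ultimately show ?thesis using i by (auto simp: level_below c_def)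
    qed
    then have "(\<Sum>i=1..<k. c (i, level s (k, t, \<delta>) i)) = (\<Sum>i=1..<k. real (\<delta> i) * x $ ix i)"
      by (intro sum.cong) auto
    moreover have "{1..k} = insert k {1..<k}" using k by auto
    ultimately have "l (route_vector s (k, t, \<delta>)) =
        - trop_poly h k t x + (\<Sum>i=1..<k. real (\<delta> i) * x $ ix i)"
      unfolding l_def sum_lookup_route_vector[OF R] using k by (simp add: c_def)
    then show ?thesis by (simp add: trop_term_def)
  qed
  have min: "trop_term h k t x \<delta> = trop_poly h k t x" if "\<delta> \<in> trop_minimizers h k t x" for k t \<delta>
    using that by (simp add: trop_minimizers_eq)
  have zero: "(k, t, \<delta>) \<in> routes s \<and> l (route_vector s (k, t, \<delta>)) + h (k, t, \<delta>) = 0"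
    if "(k, t) \<in> trop_index s" "\<delta> \<in> trop_minimizers h k t x" for k t \<delta>
    using trop_index_routes[OF that] l[OF trop_index_routes[OF that]] min[OF that(2)] by simp
  show ?thesis
  proof (rule admissible_coherent[OF adm])
    show "linear l" unfolding l_def by (rule linear_lookup_sum)
    show "0 \<le> l (route_vector s R) + h R" if R: "R \<in> routes s" for R
    proof -
      obtain k t \<delta> where kt: "R = (k, t, \<delta>)" by (cases R)
      then have "\<delta> \<in> cube (k - 1)" using R by (auto simp: routes_def)
      then have "trop_poly h k t x \<le> trop_term h k t x \<delta>"
        by (rule trop_poly_le)
      then show ?thesis using l R kt by simp
    qed
  qed (use zero[OF P] zero[OF Q] in simp_all)
qed

section \<open>Minimizers of the top polynomial over a bounded cell\<close>

lemma finite_total_greatest: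
  assumes "finite T" "T \<noteq> {}" "transp r" "\<And>x y. x \<in> T \<Longrightarrow> y \<in> T \<Longrightarrow> r x y \<or> r y x"
  shows "\<exists>g\<in>T. \<forall>x\<in>T. r x g"
  using assms(1,2,4)
proof (induction T rule: finite_ne_induct)
  case (insert a T)
  then obtain g where g: "g \<in> T" "\<forall>x\<in>T. r x g" by blast
  consider "r a g" | "r g a" using insert.prems[of a g] g(1) by blast
  then show ?case
  proof cases
    case 2
    then have "r x a" if "x \<in> T" for x using g(2) that transpD[OF assms(3)] by blast
    then show ?thesis using insert.prems[of a a] by blast
  qed (use g in blast)
qed simp

text \<open>Since s_{n+1} = 2, there is a single polynomial in all n variables.\<close>

lemma part_index_top: "s \<noteq> [] \<Longrightarrow> (length s + 1, t) \<in> trop_index s \<longleftrightarrow> t = 1"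
  using part_last[of s] by (cases s) (auto simp: trop_index_def)

text \<open>Boundedness makes both values occur at every coordinate, and coherence moves these
  occurrences into \<open>?T\<close>. Coherence also makes \<open>?T\<close> a chain, so its largest
  and smallest elements are the constant vectors.\<close>

lemma bounded_cell_imp_constant_minimizers:
  fixes x :: "real ^ 'n::{finite,linorder}"
  assumes s: "composition s" and n: "length s = CARD('n)" and adm: "admissible s h"
    and bdd: "bounded (trop_cell s h x)" and v: "v \<in> {0, 1::nat}"
  shows "restrict (\<lambda>i. v) {1..length s} \<in> trop_minimizers h (length s + 1) 1 x"
proof -
  let ?n = "length s"
  let ?T = "trop_minimizers h (?n + 1) 1 x"
  have ne: "s \<noteq> []" using n by auto
  have top: "(?n + 1, 1) \<in> trop_index s" using part_index_top[OF ne] by simp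
  note coherent = minimizers_coherent[OF s adm]
  have mono: "\<gamma> i * part s i \<le> level s (k, t, \<delta>) i"
      if "(k, t) \<in> trop_index s" "\<delta> \<in> trop_minimizers h k t x" "\<gamma> \<in> ?T" "1 \<le> i" "i < c" "c \<le> k" "c \<le> ?n"
        "\<gamma> c * part s c < level s (k, t, \<delta>) c" for k t \<delta> \<gamma> i c
  proof -
    have "level s (?n + 1, 1, \<gamma>) i \<le> level s (k, t, \<delta>) i"
    proof (rule coherent_level_mono[OF s trop_index_routes[OF top that(3)]
          trop_index_routes[OF that(1,2)] coherent[OF top that(3,1,2)] that(4,5)])
      show "level s (?n + 1, 1, \<gamma>) c < level s (k, t, \<delta>) c"
        using that(7,8) level_below[of c "?n + 1"] by simp
    qed (use that(6,7) in auto)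
    then show ?thesis using that(5,7) level_below[of i "?n + 1"] by simp
  qed
  have mono': "level s (k, t, \<delta>) i \<le> \<gamma> i * part s i"
      if "(k, t) \<in> trop_index s" "\<delta> \<in> trop_minimizers h k t x" "\<gamma> \<in> ?T" "1 \<le> i" "i < c" "c \<le> k" "c \<le> ?n"
        "level s (k, t, \<delta>) c < \<gamma> c * part s c" for k t \<delta> \<gamma> i c
  proof -
    have "level s (k, t, \<delta>) i \<le> level s (?n + 1, 1, \<gamma>) i"
    proof (rule coherent_level_mono[OF s trop_index_routes[OF that(1,2)]
          trop_index_routes[OF top that(3)] coherent[OF that(1,2) top that(3)] that(4,5)])
      show "level s (k, t, \<delta>) c < level s (?n + 1, 1, \<gamma>) c"
        using that(7,8) level_below[of c "?n + 1"] by simp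
    qed (use that(6,7) in auto)
    then show ?thesis using that(5,7) level_below[of i "?n + 1"] by simp
  qed
  have pos: "0 < part s i" if "i \<in> {1..?n}" for i using that by (intro part_pos s) auto
  have T_cases: "\<delta> i = 0 \<or> \<delta> i = 1" if "\<delta> \<in> ?T" "i \<in> {1..?n}" for \<delta> i
    using that cube_cases[of \<delta> ?n i] by (auto simp: trop_minimizers_def)

  \<comment> \<open>Downward induction on \<open>i\<close>: the witness from
    \<open>both_values_occur\<close> has top index \<open>k > i\<close>, so it is either already in
    \<open>?T\<close> or handled through the induction hypothesis at \<open>k\<close>.\<close>
  have attained: "\<exists>\<delta>\<in>?T. \<delta> i = v" if i: "i \<in> {1..?n}" and v: "v \<in> {0, 1}" for i v
    using i
  proof (induction "?n - i" arbitrary: i rule: less_induct)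
    case less
    obtain k t \<delta> where \<delta>: "\<delta> \<in> trop_minimizers h k t x" "(k, t) \<in> trop_index s" "i < k" "\<delta> i = v"
      using both_values_occur[OF n bdd less.prems v] by blast
    show ?case
    proof (cases "k = ?n + 1")
      case True
      then show ?thesis using \<delta> part_index_top[OF ne] by auto
    next
      case False
      then have k: "k \<in> {1..?n}" "1 \<le> t" "t < part s k" "i < k"
        using \<delta> by (auto simp: trop_index_def)
      moreover from this have "?n - k < ?n - i" by (intro diff_less_mono2) auto
      \<comment> \<open>The source index \<open>t\<close> lies strictly between 0 and
        \<open>part s k\<close>, the two possible levels of \<open>\<gamma>\<close> at
        \<open>k\<close>. So the routes differ strictly at \<open>k\<close>, in the sense dictated
        by \<open>v\<close>, and coherence carries this to \<open>i\<close>.\<close>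
      ultimately obtain \<gamma> where \<gamma>: "\<gamma> \<in> ?T" "\<gamma> k = v" using less.hyps[of k] by blast
      have i: "1 \<le> i" using less.prems by simp
      have "\<gamma> i = v"
      proof (cases "v = 0")
        case True
        then have "\<gamma> i * part s i \<le> \<delta> i * part s i"
          using mono[OF \<delta>(2,1) \<gamma>(1) i \<delta>(3)] k \<gamma>(2) \<delta>(3) by (simp add: level_below)
        then show ?thesis using True \<delta>(4) pos[OF less.prems] by simp
      next
        case False
        then have "v = 1" using v by simp
        then have "\<delta> i * part s i \<le> \<gamma> i * part s i"
          using mono'[OF \<delta>(2,1) \<gamma>(1) i \<delta>(3)] k \<gamma>(2) \<delta>(3) by (simp add: level_below)
        then have "1 \<le> \<gamma> i" using \<open>v = 1\<close> \<delta>(4) pos[OF less.prems] by simp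
        then show ?thesis using T_cases[OF \<gamma>(1) less.prems] \<open>v = 1\<close> by auto
      qed
      then show ?thesis using \<gamma> by blast
    qed
  qed

  define le :: "(nat \<Rightarrow> nat) \<Rightarrow> (nat \<Rightarrow> nat) \<Rightarrow> bool"
    where "le \<delta> \<gamma> \<longleftrightarrow> (\<forall>i\<in>{1..?n}. \<delta> i \<le> \<gamma> i)" for \<delta> \<gamma>
  have trans: "transp le" by (intro transpI) (auto simp: le_def intro: order_trans)
  have step: "\<gamma> i \<le> \<delta> i"
    if "\<gamma> \<in> ?T" "\<delta> \<in> ?T" "i \<in> {1..?n}" "i < c" "c \<in> {1..?n}" "\<gamma> c < \<delta> c" for \<gamma> \<delta> i c
    using mono[OF top that(2,1), of i c] that pos[of i] pos[of c] by (simp add: level_below)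
  have total: "le \<delta> \<gamma> \<or> le \<gamma> \<delta>" if "\<delta> \<in> ?T" "\<gamma> \<in> ?T" for \<delta> \<gamma>
  proof (rule ccontr)
    assume "\<not> (le \<delta> \<gamma> \<or> le \<gamma> \<delta>)"
    then obtain i j where ij: "i \<in> {1..?n}" "j \<in> {1..?n}" "\<gamma> i < \<delta> i" "\<delta> j < \<gamma> j"
      by (auto simp: le_def not_le)
    \<comment> \<open>The strict comparison at the larger index dictates the order at the smaller
      one.\<close>
    then consider "i < j" | "j < i" by (cases i j rule: linorder_cases) auto
    then show False
      using step[OF that(2,1), of j i] step[OF that, of i j] ij by cases auto
  qed
  have fin: "finite ?T" by (simp add: trop_minimizers_def finite_cube)
  have "1 \<in> {1..?n}" using ne by (simp add: Suc_le_eq)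
  then have nonempty: "?T \<noteq> {}" using attained[OF _ v, of 1] by blast
  have "\<exists>g\<in>?T. \<forall>\<delta>\<in>?T. le \<delta> g"
    by (rule finite_total_greatest[OF fin nonempty trans]) (rule total)
  then obtain g where g: "g \<in> ?T" "\<And>\<delta>. \<delta> \<in> ?T \<Longrightarrow> le \<delta> g" by blast
  have trans': "transp (\<lambda>\<delta> \<gamma>. le \<gamma> \<delta>)" by (intro transpI) (auto simp: le_def intro: order_trans)
  have "\<exists>g\<in>?T. \<forall>\<delta>\<in>?T. le g \<delta>"
    by (rule finite_total_greatest[OF fin nonempty trans']) (rule total)
  then obtain g' where g': "g' \<in> ?T" "\<And>\<delta>. \<delta> \<in> ?T \<Longrightarrow> le g' \<delta>" by blast
  \<comment> \<open>An extreme element dominates, or is dominated by, the minimizers attaining 1 and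
    0 at \<open>i\<close>.\<close>
  have "g i = 1 \<and> g' i = 0" if i: "i \<in> {1..?n}" for i
  proof -
    obtain \<delta> \<gamma> where "\<delta> \<in> ?T" "\<delta> i = 1" "\<gamma> \<in> ?T" "\<gamma> i = 0"
      using attained[OF i, of 1] attained[OF i, of 0] by blast
    then have "\<delta> i \<le> g i" "g' i \<le> \<gamma> i" "\<delta> i = 1" "\<gamma> i = 0"
      using g(2)[of \<delta>] g'(2)[of \<gamma>] i unfolding le_def by blast+
    then show ?thesis using T_cases[OF g(1) i] by auto
  qed
  then have gi: "g i = 1" "g' i = 0" if "i \<in> {1..?n}" for i using that by blast+
  have cube: "g \<in> cube ?n" "g' \<in> cube ?n" using g g' by (auto simp: trop_minimizers_def)
  have const: "restrict (\<lambda>i. v) {1..?n} \<in> cube ?n" if "v \<in> {0, 1}" for v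
    using that by (simp add: cube_def)
  have "g = restrict (\<lambda>i. 1) {1..?n}"
    by (rule cube_eqI[OF cube(1) const]) (simp_all add: gi)
  moreover have "g' = restrict (\<lambda>i. 0) {1..?n}"
    by (rule cube_eqI[OF cube(2) const]) (simp_all add: gi)
  ultimately show ?thesis using g(1) g'(1) v by auto
qed

section \<open>The zonotope as a set of minimizers\<close>

definition pairs :: "nat \<Rightarrow> (nat \<times> nat) set" where
  "pairs n = {(a, c). 1 \<le> a \<and> a < c \<and> c \<le> n}"

definition pair_weight :: "nat list \<Rightarrow> real \<Rightarrow> nat \<times> nat \<Rightarrow> real" where
  "pair_weight s \<epsilon> p = real (part s (snd p)) * \<epsilon> ^ (snd p - fst p)"

text \<open>Collects the linear terms of the squares in \<open>h_eps\<close> for 0/1 values. A pair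
  with c at most n contributes s_c^2 at c and 1 at a. For c = n+1 the level is 1, and (1 + d)^2 = 1
  + 3 d explains the factor 3.\<close>

definition zonotope_shift :: "nat list \<Rightarrow> real \<Rightarrow> real ^ 'n::{finite,linorder}" where
  "zonotope_shift s \<epsilon> =
     (\<Sum>(a, c)\<in>pairs (length s).
        \<epsilon> ^ (c - a) *\<^sub>R ((real (part s c))\<^sup>2 *\<^sub>R axis (ix c) 1 + axis (ix a) 1)) +
     (\<Sum>a = 1..length s. (3 * \<epsilon> ^ (length s + 1 - a)) *\<^sub>R axis (ix a) 1)"

definition cube_indicator :: "nat \<Rightarrow> nat set \<Rightarrow> nat \<Rightarrow> nat" where
  "cube_indicator n A = (\<lambda>i\<in>{1..n}. of_bool (i \<in> A))"

lemma pairs_subset: "pairs n \<subseteq> {1..n} \<times> {1..n}"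
  by (auto simp: pairs_def)

lemma finite_pairs: "finite (pairs n)"
  using pairs_subset by (rule finite_subset) simp

lemma pairs_Suc: "pairs (n + 1) = pairs n \<union> (\<lambda>a. (a, n + 1)) ` {1..n}"
  by (auto simp: pairs_def)

text \<open>Separates the pairs whose larger entry is the top index, where the level is that of the
  source edge rather than of a bump or dip.\<close>

lemma sum_pairs_Suc:
  fixes f :: "nat \<Rightarrow> nat \<Rightarrow> real"
  shows "(\<Sum>(a, c)\<in>pairs (n + 1). f a c) = (\<Sum>(a, c)\<in>pairs n. f a c) + (\<Sum>a = 1..n. f a (n + 1))"
proof -
  have "(\<Sum>(a, c)\<in>(\<lambda>a. (a, n + 1)) ` {1..n}. f a c) = (\<Sum>a = 1..n. f a (n + 1))"
    by (subst sum.reindex) (auto simp: inj_on_def)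
  moreover have "pairs n \<inter> (\<lambda>a. (a, n + 1)) ` {1..n} = {}" by (auto simp: pairs_def)
  ultimately show ?thesis
    unfolding pairs_Suc by (subst sum.union_disjoint) (auto simp: finite_pairs)
qed

lemma cube_eq_indicators: "cube n = cube_indicator n ` Pow {1..n}"
proof (intro equalityI subsetI)
  fix \<delta> assume \<delta>: "\<delta> \<in> cube n"
  have "cube_indicator n {i \<in> {1..n}. \<delta> i = 1} \<in> cube n"
    by (auto simp: cube_indicator_def cube_def)
  then have "\<delta> = cube_indicator n {i \<in> {1..n}. \<delta> i = 1}"
  proof (rule cube_eqI[OF \<delta>])
    fix i assume i: "i \<in> {1..n}"
    then show "\<delta> i = cube_indicator n {i \<in> {1..n}. \<delta> i = 1} i"
      using cube_cases[OF \<delta>, of i] by (auto simp: cube_indicator_def)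
  qed
  then show "\<delta> \<in> cube_indicator n ` Pow {1..n}" by blast
qed (auto simp: cube_indicator_def cube_def)

section \<open>Expansion of the top polynomial\<close>

lemma trop_gradient_shift:
  assumes n: "length s = CARD('n::{finite,linorder})"
  shows "trop_gradient (length s + 1) \<delta> \<bullet> (zonotope_shift s \<epsilon> :: real ^ 'n::{finite,linorder}) =
    (\<Sum>(a, c)\<in>pairs (length s). \<epsilon> ^ (c - a) * ((real (part s c))\<^sup>2 * real (\<delta> c) + real (\<delta> a))) +
    (\<Sum>a = 1..length s. 3 * \<epsilon> ^ (length s + 1 - a) * real (\<delta> a))"
proof -
  define G where "G = (trop_gradient (length s + 1) \<delta> :: (real, 'n) vec)"
  have axis: "G \<bullet> axis (ix i) 1 = real (\<delta> i)" if "i \<in> {1..length s}" for i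
    using trop_gradient_axis[OF n that, of "length s + 1" \<delta>] that by (simp add: G_def)
  show ?thesis
    unfolding zonotope_shift_def inner_add_right inner_sum_right G_def[symmetric]
  proof (intro arg_cong2[where f = "(+)"] sum.cong refl)
    fix p assume "p \<in> pairs (length s)"
    then obtain a c where "p = (a, c)" "a \<in> {1..length s}" "c \<in> {1..length s}"
      using pairs_subset by blast
    then show "G \<bullet> (case p of (a, c) \<Rightarrow>
          \<epsilon> ^ (c - a) *\<^sub>R ((real (part s c))\<^sup>2 *\<^sub>R axis (ix c) 1 + axis (ix a) 1)) =
        (case p of (a, c) \<Rightarrow> \<epsilon> ^ (c - a) * ((real (part s c))\<^sup>2 * real (\<delta> c) + real (\<delta> a)))"
      by (simp add: inner_add_right axis)
  qed (simp add: axis)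
qed

text \<open>Squares of 0/1 values linearize. What remains is a constant, a linear part centred at
  the shift, and the mixed products with weights \<open>pair_weight\<close>.\<close>

lemma trop_term_h_eps:
  fixes x :: "real ^ 'n::{finite,linorder}"
  assumes n: "length s = CARD('n)" and \<delta>: "\<delta> \<in> cube (length s)"
  shows "trop_term (h_eps s \<epsilon>) (length s + 1) 1 x \<delta> =
    - (\<Sum>a = 1..length s. \<epsilon> ^ (length s + 1 - a)) +
    trop_gradient (length s + 1) \<delta> \<bullet> (x - zonotope_shift s \<epsilon>) -
    2 * (\<Sum>p\<in>pairs (length s). pair_weight s \<epsilon> p * (real (\<delta> (fst p)) * real (\<delta> (snd p))))"
proof -
  let ?n = "length s"
  let ?f = "\<lambda>a c. \<epsilon> ^ (c - a) * (real (level s (?n + 1, 1, \<delta>) c) + real (\<delta> a))\<^sup>2"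
  have sq: "(real (\<delta> i))\<^sup>2 = real (\<delta> i)" if "i \<in> {1..?n}" for i
    using that cube_cases[OF \<delta>, of i] by auto
  have inner: "?f a c = \<epsilon> ^ (c - a) * ((real (part s c))\<^sup>2 * real (\<delta> c) + real (\<delta> a)) +
      2 * (pair_weight s \<epsilon> (a, c) * (real (\<delta> a) * real (\<delta> c)))"
    if "(a, c) \<in> pairs ?n" for a c
  proof -
    have ac: "a \<in> {1..?n}" "c \<in> {1..?n}" using that by (auto simp: pairs_def)
    have "level s (?n + 1, 1, \<delta>) c = \<delta> c * part s c" using ac by (intro level_below) auto
    then have "?f a c = \<epsilon> ^ (c - a) * ((real (part s c))\<^sup>2 * (real (\<delta> c))\<^sup>2 + (real (\<delta> a))\<^sup>2 +
        2 * (real (part s c) * (real (\<delta> a) * real (\<delta> c))))"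
      by (simp add: power2_eq_square algebra_simps)
    then show ?thesis
      unfolding sq[OF ac(1)] sq[OF ac(2)] by (simp add: pair_weight_def algebra_simps)
  qed
  have last: "?f a (?n + 1) = \<epsilon> ^ (?n + 1 - a) + 3 * \<epsilon> ^ (?n + 1 - a) * real (\<delta> a)"
    if "a \<in> {1..?n}" for a
  proof -
    have "?f a (?n + 1) = \<epsilon> ^ (?n + 1 - a) * (1 + 2 * real (\<delta> a) + (real (\<delta> a))\<^sup>2)"
      by (simp add: power2_eq_square algebra_simps)
    then show ?thesis unfolding sq[OF that] by (simp add: algebra_simps)
  qed
  have "h_eps s \<epsilon> (?n + 1, 1, \<delta>) = - (\<Sum>(a, c)\<in>pairs (?n + 1). ?f a c)"
    by (simp add: h_eps_def pairs_def)
  also have "(\<Sum>(a, c)\<in>pairs (?n + 1). ?f a c) =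
      (\<Sum>(a, c)\<in>pairs ?n. \<epsilon> ^ (c - a) * ((real (part s c))\<^sup>2 * real (\<delta> c) + real (\<delta> a)) +
        2 * (pair_weight s \<epsilon> (a, c) * (real (\<delta> a) * real (\<delta> c)))) +
      (\<Sum>a = 1..?n. \<epsilon> ^ (?n + 1 - a) + 3 * \<epsilon> ^ (?n + 1 - a) * real (\<delta> a))"
    unfolding sum_pairs_Suc using inner last
    by (intro arg_cong2[where f = "(+)"] sum.cong refl) auto
  also have "\<dots> = trop_gradient (?n + 1) \<delta> \<bullet> (zonotope_shift s \<epsilon> :: (real, 'n) vec) +
      2 * (\<Sum>p\<in>pairs ?n. pair_weight s \<epsilon> p * (real (\<delta> (fst p)) * real (\<delta> (snd p)))) +
      (\<Sum>a = 1..?n. \<epsilon> ^ (?n + 1 - a))"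
    unfolding trop_gradient_shift[OF n] by (simp add: case_prod_unfold sum.distrib sum_distrib_left)
  finally show ?thesis by (simp add: trop_term_gradient inner_diff_right)
qed

text \<open>Read on subsets, the term is a modular function minus twice the weight of the pairs
  inside \<open>A\<close>, up to a constant independent of \<open>A\<close>.\<close>

lemma trop_term_indicator:
  fixes x :: "real ^ 'n::{finite,linorder}"
  assumes n: "length s = CARD('n)" and A: "A \<subseteq> {1..length s}"
  shows "trop_term (h_eps s \<epsilon>) (length s + 1) 1 x (cube_indicator (length s) A) =
    - (\<Sum>a = 1..length s. \<epsilon> ^ (length s + 1 - a)) +
    (\<Sum>v\<in>A. (x - zonotope_shift s \<epsilon>) \<bullet> axis (ix v) 1) -
    2 * (\<Sum>p\<in>pairs (length s). pair_weight s \<epsilon> p * of_bool (fst p \<in> A \<and> snd p \<in> A))"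
proof -
  let ?n = "length s"
  let ?y = "x - zonotope_shift s \<epsilon>"
  have val: "real (cube_indicator ?n A i) = of_bool (i \<in> A)" if "i \<in> {1..?n}" for i
    using that by (simp add: cube_indicator_def)
  have "trop_gradient (?n + 1) (cube_indicator ?n A) \<bullet> ?y =
      (\<Sum>v\<in>{1..<?n + 1}. real (cube_indicator ?n A v) * (?y \<bullet> axis (ix v) 1))"
    unfolding trop_gradient_def inner_sum_left by (simp add: inner_commute)
  also have "\<dots> = (\<Sum>v\<in>A. ?y \<bullet> axis (ix v) 1)"
  proof (rule sum.mono_neutral_cong_right)
    show "real (cube_indicator ?n A v) * (?y \<bullet> axis (ix v) 1) = ?y \<bullet> axis (ix v) 1" if "v \<in> A" for v
      using val[of v] that A by (simp add: subset_iff)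
  qed (use A in \<open>auto simp: cube_indicator_def\<close>)
  finally have "trop_gradient (?n + 1) (cube_indicator ?n A) \<bullet> ?y = (\<Sum>v\<in>A. ?y \<bullet> axis (ix v) 1)" .
  moreover have "(\<Sum>p\<in>pairs ?n. pair_weight s \<epsilon> p *
        (real (cube_indicator ?n A (fst p)) * real (cube_indicator ?n A (snd p)))) =
      (\<Sum>p\<in>pairs ?n. pair_weight s \<epsilon> p * of_bool (fst p \<in> A \<and> snd p \<in> A))"
  proof (rule sum.cong[OF refl])
    fix p assume "p \<in> pairs ?n"
    then have "fst p \<in> {1..?n}" "snd p \<in> {1..?n}" by (auto simp: pairs_def)
    then show "pair_weight s \<epsilon> p * (real (cube_indicator ?n A (fst p)) * real (cube_indicator ?n A (snd p))) =
        pair_weight s \<epsilon> p * of_bool (fst p \<in> A \<and> snd p \<in> A)"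
      by (simp add: val)
  qed
  moreover have "cube_indicator ?n A \<in> cube ?n" using A by (auto simp: cube_eq_indicators)
  ultimately show ?thesis using trop_term_h_eps[OF n, of "cube_indicator ?n A" \<epsilon> x] by simp
qed

lemma zonotope_eq:
  "zonotope s \<epsilon> = (*\<^sub>R) 2 ` (\<Sum>p\<in>pairs (length s). (*\<^sub>R) (pair_weight s \<epsilon> p) `
     closed_segment (axis (ix (fst p)) 1) (axis (ix (snd p)) 1))"
  by (simp add: zonotope_def pairs_def pair_weight_def case_prod_unfold)

lemma bounded_zonotope: "bounded (zonotope s \<epsilon>)"
  unfolding zonotope_eq
  by (intro compact_imp_bounded compact_scaling compact_sum_segments finite_pairs)

text \<open>Minimality of the empty set gives the base polytope inequalities, and minimality of the
  full set adds the equality for the total.\<close>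

lemma mem_zonotope_iff_minimizers:
  fixes x :: "real ^ 'n::{finite,linorder}"
  assumes n: "length s = CARD('n)" and \<epsilon>: "0 < \<epsilon>"
  shows "x - zonotope_shift s \<epsilon> \<in> zonotope s \<epsilon> \<longleftrightarrow>
    (\<forall>v\<in>{0, 1}. (\<lambda>i\<in>{1..length s}. v) \<in> trop_minimizers (h_eps s \<epsilon>) (length s + 1) 1 x)"
proof -
  let ?V = "{1..length s}"
  let ?E = "pairs (length s)"
  let ?y = "x - zonotope_shift s \<epsilon>"
  define W where "W A = (\<Sum>p\<in>?E. pair_weight s \<epsilon> p * of_bool (fst p \<in> A \<and> snd p \<in> A))" for A
  define Y where "Y A = (\<Sum>v\<in>A. ?y \<bullet> axis (ix v) 1)" for A
  have trop: "trop_term (h_eps s \<epsilon>) (length s + 1) 1 x (cube_indicator (length s) A) =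
      - (\<Sum>a = 1..length s. \<epsilon> ^ (length s + 1 - a)) + Y A - 2 * W A" if "A \<subseteq> ?V" for A
    using trop_term_indicator[OF n that] by (simp add: W_def Y_def)
  have min: "cube_indicator (length s) B \<in> trop_minimizers (h_eps s \<epsilon>) (length s + 1) 1 x \<longleftrightarrow>
      (\<forall>A\<subseteq>?V. Y B - 2 * W B \<le> Y A - 2 * W A)" if "B \<subseteq> ?V" for B
    using that trop by (auto simp: trop_minimizers_def cube_eq_indicators)
  have corners: "(\<lambda>i\<in>?V. 0) = cube_indicator (length s) {}"
      "(\<lambda>i\<in>?V. 1) = cube_indicator (length s) ?V"
    by (auto simp: cube_indicator_def restrict_def)
  have empty: "Y {} = 0" "W {} = 0" by (simp_all add: Y_def W_def)
  \<comment> \<open>The outer factor 2 of the zonotope is moved to the point, so the graphical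
    criterion is applied to half of \<open>?y\<close>.\<close>
  have half: "(\<Sum>v\<in>A. ((1 / 2) *\<^sub>R ?y) \<bullet> axis (ix v) 1) = Y A / 2" for A
    unfolding Y_def inner_scaleR_left sum_distrib_left[symmetric] by simp
  have total: "W ?V = (\<Sum>p\<in>?E. pair_weight s \<epsilon> p)"
    unfolding W_def by (intro sum.cong) (auto simp: pairs_def)
  have "z \<in> (*\<^sub>R) 2 ` S \<longleftrightarrow> (1 / 2) *\<^sub>R z \<in> S" for z and S :: "(real, 'n) vec set"
  proof
    assume "(1 / 2) *\<^sub>R z \<in> S"
    then have "2 *\<^sub>R ((1 / 2) *\<^sub>R z) \<in> (*\<^sub>R) 2 ` S" by (rule imageI)
    then show "z \<in> (*\<^sub>R) 2 ` S" by simp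
  qed auto
  then have "?y \<in> zonotope s \<epsilon> \<longleftrightarrow> (1 / 2) *\<^sub>R ?y \<in> (\<Sum>p\<in>?E. (*\<^sub>R) (pair_weight s \<epsilon> p) `
      closed_segment (axis (ix (fst p)) 1) (axis (ix (snd p)) 1))"
    unfolding zonotope_eq by blast
  also have "\<dots> \<longleftrightarrow> (\<forall>A\<subseteq>?V. W A \<le> (\<Sum>v\<in>A. ((1 / 2) *\<^sub>R ?y) \<bullet> axis (ix v) 1)) \<and>
      (\<Sum>p\<in>?E. pair_weight s \<epsilon> p) = (\<Sum>v\<in>?V. ((1 / 2) *\<^sub>R ?y) \<bullet> axis (ix v) 1)"
    unfolding W_def using \<epsilon>
    by (intro mem_graphical_zonotope_iff finite_pairs pairs_subset axis_ix_bij_betw n)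
      (simp_all add: pair_weight_def)
  also have "\<dots> \<longleftrightarrow> (\<forall>A\<subseteq>?V. 2 * W A \<le> Y A) \<and> 2 * W ?V = Y ?V"
    unfolding half total[symmetric] by (simp add: pos_le_divide_eq eq_divide_eq mult.commute)
  also have "\<dots> \<longleftrightarrow> (\<forall>v\<in>{0, 1}. (\<lambda>i\<in>?V. v) \<in> trop_minimizers (h_eps s \<epsilon>) (length s + 1) 1 x)"
  proof -
    have "(\<forall>A\<subseteq>?V. 2 * W A \<le> Y A) \<and> 2 * W ?V = Y ?V \<longleftrightarrow>
        (\<forall>A\<subseteq>?V. Y {} - 2 * W {} \<le> Y A - 2 * W A) \<and>
        (\<forall>A\<subseteq>?V. Y ?V - 2 * W ?V \<le> Y A - 2 * W A)" (is "?L \<longleftrightarrow> ?R1 \<and> ?R2")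
    proof
      assume L: ?L
      then show "?R1 \<and> ?R2" by (simp add: empty)
    next
      assume R: "?R1 \<and> ?R2"
      then have "2 * W A \<le> Y A" if "A \<subseteq> ?V" for A using that by (simp add: empty)
      \<comment> \<open>Comparing the full set with the empty one gives the missing half of the
        equality.\<close>
      moreover have "Y ?V - 2 * W ?V \<le> Y {} - 2 * W {}" using R by blast
      ultimately show ?L using empty by (simp add: antisym)
    qed
    then show ?thesis using min[of "{}"] min[of ?V] corners by simp
  qed
  finally show ?thesis .
qed

text \<open>The constant vectors that minimize at \<open>x\<close> minimize on its whole cell, which
  thus stays inside the translated zonotope.\<close>

lemma cell_in_zonotope_bounded:
  fixes x :: "real ^ 'n::{finite,linorder}"
  assumes n: "length s = CARD('n)" and \<epsilon>: "0 < \<epsilon>" and x: "x - zonotope_shift s \<epsilon> \<in> zonotope s \<epsilon>"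
  shows "bounded (trop_cell s (h_eps s \<epsilon>) x)"
proof (rule bounded_subset)
  show "bounded ((+) (zonotope_shift s \<epsilon>) ` zonotope s \<epsilon> :: (real, 'n) vec set)"
    by (intro bounded_translation bounded_zonotope)
  show "trop_cell s (h_eps s \<epsilon>) x \<subseteq> (+) (zonotope_shift s \<epsilon>) ` zonotope s \<epsilon>"
  proof
    fix y assume y: "y \<in> trop_cell s (h_eps s \<epsilon>) x"
    have "s \<noteq> []" using n by auto
    then have "(length s + 1, 1) \<in> trop_index s" using part_index_top by blast
    then have "trop_minimizers (h_eps s \<epsilon>) (length s + 1) 1 x \<subseteq>
        trop_minimizers (h_eps s \<epsilon>) (length s + 1) 1 y"
      using y unfolding trop_cell_def by blast
    then have "y - zonotope_shift s \<epsilon> \<in> zonotope s \<epsilon>"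
      using x unfolding mem_zonotope_iff_minimizers[OF n \<epsilon>] by blast
    then show "y \<in> (+) (zonotope_shift s \<epsilon>) ` zonotope s \<epsilon>"
      by (rule image_eqI[rotated]) simp
  qed
qed

theorem theorem6p39:
  fixes s :: "nat list" and \<epsilon> :: real
  assumes "composition s"
    and "length s = CARD('n::{finite,linorder})"
    and "0 < \<epsilon>"
    and "admissible s (h_eps s \<epsilon>)"
  shows "\<exists>v :: real ^ 'n::{finite,linorder}. \<Union> (Perm s (h_eps s \<epsilon>)) = (+) v ` zonotope s \<epsilon>"
proof -
  \<comment> \<open>Only the forward direction uses admissibility, through coherence of
    minimizers.\<close>
  have "bounded (trop_cell s (h_eps s \<epsilon>) x) \<longleftrightarrow> x - zonotope_shift s \<epsilon> \<in> zonotope s \<epsilon>"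
    for x :: "(real, 'n) vec"
    using bounded_cell_imp_constant_minimizers[OF assms(1,2,4), of x]
      cell_in_zonotope_bounded[OF assms(2,3), of x]
      mem_zonotope_iff_minimizers[OF assms(2,3), of x] by blast
  then have "\<Union> (Perm s (h_eps s \<epsilon>)) =
      {x :: (real, 'n) vec. x - zonotope_shift s \<epsilon> \<in> zonotope s \<epsilon>}"
    unfolding Union_Perm[OF assms(2)] by blast
  also have "\<dots> = (+) (zonotope_shift s \<epsilon>) ` zonotope s \<epsilon>"
    by (force simp: image_iff algebra_simps)
  finally show ?thesis by blast
qed

end
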